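(* Let $V$ and $W$ be two finite dimensional representations of $\mathrm{SU}(2)$ such that the center of $\mathrm{SU}(2)$ operates by scalars on $V$ and on $W$. Then we have the following estimates. (1) If the central characters of $V$ and $W$ are the same, then $$\dim\big(V\otimes V[0]\oplus W\otimes W[0]\big)\;\geq\; 2\dim\big(V\otimes W[0]\big);$$ further, the inequality becomes an equality if and only if $V=W$ (as representations, i.e. up to isomorphism). (This part of the lemma remains true for the zero weight space for a maximal torus in any compact Lie group.) (2) If the central characters of $V$ and $W$ are opposite, then $$\dim\big(V\otimes V[0]\oplus W\otimes W[0]\big)\;\geq\; 2\dim\big(V\otimes W[1]\big);$$ further, the inequality is never an equality.
   Context: For a finite dimensional representation $E$ of $\mathrm{SU}(2)$ and an integer $i$, $E[i]$ denotes the subspace of $E$ on which the standard maximal torus $\mathbb{S}^1$ of $\mathrm{SU}(2)$ operates by the character $z\mapsto z^i$; $V\otimes W[i]$ means $(V\otimes W)[i]$, and similarly for $V\otimes V[i]$ and $W\otimes W[i]$. The central character of a representation on which the center $\{\pm 1\}$ of $\mathrm{SU}(2)$ acts by scalars is the character of $\{\pm 1\}$ giving these scalars; the central characters of $V$ and $W$ are opposite if they are different, i.e. $-1$ acts by $+1$ on one of $V, W$ and by $-1$ on the other. For a maximal torus in a compact Lie group, the zero weight space of a representation is the subspace on which the torus operates trivially.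
   Formalization: The remark on any compact Lie group is false as written (SU(3): Sym^3 and its dual); it is proved for self-dual V, W, with equality iff V=W over the maximal torus, and over the group when every element is conjugate into the torus. V, W are taken nonzero. *)

theory Defs
  imports "HOL-Analysis.Analysis"
begin

section \<open>Matrix groups\<close>

definition ctranspose :: "complex^'m^'n \<Rightarrow> complex^'n^'m" where
  "ctranspose A = (\<chi> i j. cnj (A $ j $ i))"

definition SU2 :: "(complex^2^2) set" where
  "SU2 = {A. ctranspose A ** A = mat 1 \<and> det A = 1}"

text \<open>The standard maximal torus of \<open>SU2\<close>, parametrised by the unit circle.\<close>

definition SU2_torus :: "complex \<Rightarrow> complex^2^2" where
  "SU2_torus z = vector [vector [z, 0], vector [0, inverse z]]"

definition group_center :: "(complex^'m^'m) set \<Rightarrow> (complex^'m^'m) set" where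
  "group_center G = {z \<in> G. \<forall>g\<in>G. z ** g = g ** z}"

text \<open>Every compact Lie group has a faithful finite-dimensional representation, so compact Lie
  groups are represented by compact subgroups of general linear groups. (A compact subgroup is
  closed in the general linear group, hence a Lie group.)\<close>

definition compact_matrix_group :: "(complex^'m^'m) set \<Rightarrow> bool" where
  "compact_matrix_group G \<longleftrightarrow> compact G \<and> mat 1 \<in> G \<and>
     (\<forall>g\<in>G. \<forall>h\<in>G. g ** h \<in> G) \<and> (\<forall>g\<in>G. invertible g \<and> matrix_inv g \<in> G)"

text \<open>A torus is a compact connected abelian Lie group.\<close>

definition torus_group :: "(complex^'m^'m) set \<Rightarrow> bool" where
  "torus_group T \<longleftrightarrow> compact_matrix_group T \<and> connected T \<and> (\<forall>s\<in>T. \<forall>t\<in>T. s ** t = t ** s)"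

definition maximal_torus :: "(complex^'m^'m) set \<Rightarrow> (complex^'m^'m) set \<Rightarrow> bool" where
  "maximal_torus G T \<longleftrightarrow> T \<subseteq> G \<and> torus_group T \<and>
     (\<forall>S. torus_group S \<and> T \<subseteq> S \<and> S \<subseteq> G \<longrightarrow> S = T)"


section \<open>Finite-dimensional complex representations\<close>

text \<open>Only the values on \<open>G\<close> are meaningful. The space acted on is \<open>complex^'n\<close>, so
  representations are nonzero; this is what makes a central character well defined.
  Invertibility of each \<open>\<rho> g\<close> follows from the group laws.\<close>

definition representation ::
    "(complex^'m^'m) set \<Rightarrow> (complex^'m^'m \<Rightarrow> complex^'n^'n) \<Rightarrow> bool" where
  "representation G \<rho> \<longleftrightarrow> continuous_on G \<rho> \<and> \<rho> (mat 1) = mat 1 \<and>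
     (\<forall>g\<in>G. \<forall>h\<in>G. \<rho> (g ** h) = \<rho> g ** \<rho> h)"

definition rep_iso ::
    "(complex^'m^'m) set \<Rightarrow> (complex^'m^'m \<Rightarrow> complex^'n^'n) \<Rightarrow>
     (complex^'m^'m \<Rightarrow> complex^'k^'k) \<Rightarrow> bool" where
  "rep_iso G \<rho> \<sigma> \<longleftrightarrow>
     (\<exists>F :: complex^'n^'k. invertible F \<and> (\<forall>g\<in>G. F ** \<rho> g = \<sigma> g ** F))"

text \<open>\<open>mat c\<close> is the scalar matrix with diagonal entries \<open>c\<close>; the values of \<open>\<omega>\<close> outside the
  center are irrelevant.\<close>

definition has_central_character ::
    "(complex^'m^'m) set \<Rightarrow> (complex^'m^'m \<Rightarrow> complex^'n^'n) \<Rightarrow> (complex^'m^'m \<Rightarrow> complex) \<Rightarrow> bool"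
  where
  "has_central_character G \<rho> \<omega> \<longleftrightarrow> (\<forall>z\<in>group_center G. \<rho> z = mat (\<omega> z))"

text \<open>The tensor product of representations, as the Kronecker product of matrices: the basis of
  the tensor product is indexed by pairs.\<close>

definition tensor_rep ::
    "(complex^'m^'m \<Rightarrow> complex^'n^'n) \<Rightarrow> (complex^'m^'m \<Rightarrow> complex^'k^'k) \<Rightarrow>
     complex^'m^'m \<Rightarrow> complex^('n \<times> 'k)^('n \<times> 'k)" where
  "tensor_rep \<rho> \<sigma> g = (\<chi> p q. \<rho> g $ fst p $ fst q * \<sigma> g $ snd p $ snd q)"

text \<open>The contragredient representation, in the dual basis.\<close>

definition dual_rep ::
    "(complex^'m^'m \<Rightarrow> complex^'n^'n) \<Rightarrow> complex^'m^'m \<Rightarrow> complex^'n^'n" where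
  "dual_rep \<rho> g = transpose (\<rho> (matrix_inv g))"

definition self_dual :: "(complex^'m^'m) set \<Rightarrow> (complex^'m^'m \<Rightarrow> complex^'n^'n) \<Rightarrow> bool" where
  "self_dual G \<rho> \<longleftrightarrow> rep_iso G \<rho> (dual_rep \<rho>)"


section \<open>Weight spaces\<close>

definition weight_space :: "int \<Rightarrow> (complex^2^2 \<Rightarrow> complex^'n^'n) \<Rightarrow> (complex^'n) set" where
  "weight_space i \<rho> = {v. \<forall>z. norm z = 1 \<longrightarrow> \<rho> (SU2_torus z) *v v = (z powi i) *s v}"

definition zero_weight_space ::
    "(complex^'m^'m) set \<Rightarrow> (complex^'m^'m \<Rightarrow> complex^'n^'n) \<Rightarrow> (complex^'n) set" where
  "zero_weight_space T \<rho> = {v. \<forall>t\<in>T. \<rho> t *v v = v}"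

text \<open>External direct sum of subspaces of \<open>complex^'n\<close> and \<open>complex^'k\<close>. Complex dimensions are
  expressed by \<open>vec.dim\<close>; the unqualified \<open>dim\<close> would be the real dimension.\<close>

definition direct_sum :: "(complex^'n) set \<Rightarrow> (complex^'k) set \<Rightarrow> (complex^('n + 'k)) set" where
  "direct_sum A B = {x. (\<chi> i. x $ Inl i) \<in> A \<and> (\<chi> j. x $ Inr j) \<in> B}"

end

theory Submission
  imports Defs
begin

text \<open>
  Everything is read off from characters. A bounded group of linear maps that preserves a nonempty
  compact convex set fixes a point of it (the minimiser of the supremum of the norms along the orbit
  is unique by the parallelogram law). Applied to the convex hull of the image of a compact group
  in a sum of representations, this gives finitely many group elements \<open>k\<close> with weights \<open>c k\<close>
  whose weighted average is the projection onto the invariants; these replace Haar measure. Applied to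
  the matrices \<open>\<rho>(g)\<^sup>* \<rho>(g)\<close>, it gives an invariant Hermitian form, so that
  \<open>tr \<rho>(g\<inverse>)\<close> is the conjugate of \<open>tr \<rho>(g)\<close>.

  Hence \<open>dim Hom(X,X) + dim Hom(Y,Y) - 2 dim Hom(X,Y)\<close> is the weighted sum of
  \<open>\<bar>tr X(k) - tr Y(k)\<bar>\<^sup>2\<close>. It is nonnegative, and if it vanishes then \<open>X\<close> and \<open>Y\<close> are isomorphic.
  On the torus the characters are real, so \<open>X \<otimes> Y\<close> and \<open>Hom(X,Y)\<close> have equally many invariants,
  which is (1). For (2), the weight 1 space of \<open>V \<otimes> W\<close> corresponds to \<open>Hom(zW, V)\<close>. Equality would
  make \<open>z tr W(z)\<close> equal to the real number \<open>tr V(z)\<close>, hence \<open>tr W(z) = 0\<close> for \<open>z\<close> not real, and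
  by continuity \<open>dim W = 0\<close>.
\<close>

section \<open>Averages over compact groups\<close>

text \<open>Closure under composition makes the orbit of \<open>f a\<close> part of the orbit of
  \<open>a\<close>, so \<open>\<phi> (f a) \<le> \<phi> a\<close>. The lower bound on
  \<open>norm (f x)\<close> makes the parallelogram gain at the midpoint uniform over
  \<open>L\<close>, so that it survives the supremum.\<close>

lemma bounded_linear_group_fixed_point:
  fixes L :: "('e::euclidean_space \<Rightarrow> 'e) set"
  assumes "L \<noteq> {}" and lin: "\<And>f. f \<in> L \<Longrightarrow> linear f"
    and comp: "\<And>f g. f \<in> L \<Longrightarrow> g \<in> L \<Longrightarrow> f \<circ> g \<in> L"
    and C: "C > 0" "\<And>f x. f \<in> L \<Longrightarrow> norm (f x) \<le> C * norm x"
      "\<And>f x. f \<in> L \<Longrightarrow> norm x \<le> C * norm (f x)"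
    and K: "compact K" "convex K" "K \<noteq> {}" and inv: "\<And>f x. f \<in> L \<Longrightarrow> x \<in> K \<Longrightarrow> f x \<in> K"
  shows "\<exists>x\<in>K. \<forall>f\<in>L. f x = x"
proof -
  define \<phi> where "\<phi> x = (SUP f\<in>L. norm (f x))" for x
  have bdd: "bdd_above ((\<lambda>f. norm (f x)) ` L)" for x
    using C(2) by (intro bdd_aboveI2[where M = "C * norm x"]) auto
  have upper: "norm (f x) \<le> \<phi> x" if "f \<in> L" for f x
    unfolding \<phi>_def by (rule cSUP_upper[OF that bdd])
  have least: "\<phi> x \<le> M" if "\<And>f. f \<in> L \<Longrightarrow> norm (f x) \<le> M" for x M
    unfolding \<phi>_def using that \<open>L \<noteq> {}\<close> by (intro cSUP_least)
  have diff: "\<phi> x \<le> \<phi> y + C * norm (x - y)" for x y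
  proof (rule least)
    fix f assume f: "f \<in> L"
    have "norm (f x) \<le> norm (f y) + norm (f (x - y))"
      using norm_triangle_ineq[of "f y" "f (x - y)"] linear_diff[OF lin[OF f]] by simp
    then show "norm (f x) \<le> \<phi> y + C * norm (x - y)"
      using upper[OF f, of y] C(2)[OF f, of "x - y"] by linarith
  qed
  have "C-lipschitz_on K \<phi>"
  proof (rule lipschitz_onI)
    show "dist (\<phi> x) (\<phi> y) \<le> C * dist x y" for x y
      using diff[of x y] diff[of y x] by (auto simp: dist_norm norm_minus_commute abs_le_iff)
  qed (use C in auto)
  then have "continuous_on K \<phi>" by (rule lipschitz_on_continuous_on)
  then obtain a where a: "a \<in> K" "\<And>x. x \<in> K \<Longrightarrow> \<phi> a \<le> \<phi> x"
    using continuous_attains_inf K by metis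
  have "f a = a" if f: "f \<in> L" for f
  proof (rule ccontr)
    assume ne: "f a \<noteq> a"
    define b where "b = f a"
    define c where "c = (1/2) *\<^sub>R a + (1/2) *\<^sub>R b"
    have b: "b \<in> K" using inv f a by (simp add: b_def)
    have cK: "c \<in> K" unfolding c_def using K(2) a b by (intro convexD) auto
    have \<phi>b: "\<phi> b \<le> \<phi> a"
      using upper[OF comp[OF _ f]] by (intro least) (auto simp: b_def)
    have \<phi>0: "0 \<le> \<phi> x" for x using upper[OF f, of x] norm_ge_zero order_trans by blast
    \<comment> \<open>The parallelogram law gives
      \<open>4 |g c|^2 = 2 |g a|^2 + 2 |g b|^2 - |g a - g b|^2\<close>, and the last norm is at
      least \<open>norm (a - b) / C\<close>, whatever \<open>g\<close> is.\<close>
    define \<delta> where "\<delta> = (norm (a - b) / C)\<^sup>2 / 4"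
    have \<delta>: "\<delta> > 0" using ne C(1) by (auto simp: \<delta>_def b_def)
    have sq: "(norm (g c))\<^sup>2 \<le> (\<phi> a)\<^sup>2 - \<delta>" if g: "g \<in> L" for g
    proof -
      have gc: "g c = (1/2) *\<^sub>R (g a + g b)" "g (a - b) = g a - g b"
        using lin[OF g] by (simp_all add: c_def linear_add linear_scale linear_diff scaleR_add_right)
      have "(norm (g a + g b))\<^sup>2 + (norm (g a - g b))\<^sup>2 = 2 * (norm (g a))\<^sup>2 + 2 * (norm (g b))\<^sup>2"
        by (simp add: power2_norm_eq_inner algebra_simps inner_commute)
      moreover have "(norm (g a))\<^sup>2 \<le> (\<phi> a)\<^sup>2" "(norm (g b))\<^sup>2 \<le> (\<phi> a)\<^sup>2"
        using upper[OF g] \<phi>b by (auto intro!: power_mono intro: order_trans)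
      moreover have "(norm (a - b) / C)\<^sup>2 \<le> (norm (g a - g b))\<^sup>2"
        using C(3)[OF g, of "a - b"] C(1) gc by (intro power_mono) (auto simp: field_simps)
      moreover have "(norm (g c))\<^sup>2 = (norm (g a + g b))\<^sup>2 / 4"
        by (simp add: gc power_divide)
      ultimately show ?thesis unfolding \<delta>_def by linarith
    qed
    have "norm (g c) \<le> sqrt ((\<phi> a)\<^sup>2 - \<delta>)" if "g \<in> L" for g
      using sq[OF that] by (simp add: real_le_rsqrt)
    then have "\<phi> c \<le> sqrt ((\<phi> a)\<^sup>2 - \<delta>)" by (rule least)
    also have "\<dots> < \<phi> a" using \<delta> \<phi>0[of a] by (simp add: real_sqrt_less_iff real_less_lsqrt sq f)
    finally show False using a(2)[OF cK] by simp
  qed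
  with a(1) show ?thesis by blast
qed

section \<open>Continuity of the matrix product and the trace of an idempotent\<close>

lemma bounded_bilinear_matrix_mult:
  "bounded_bilinear ((**) :: complex^'n^'m \<Rightarrow> complex^'k^'n \<Rightarrow> complex^'k^'m)"
  by (rule bilinear_conv_bounded_bilinear[THEN iffD1])
    (auto simp: bilinear_def linear_iff vec_eq_iff matrix_matrix_mult_def
      algebra_simps sum.distrib scaleR_sum_right)

lemmas continuous_on_matrix_mult = bounded_bilinear.continuous_on[OF bounded_bilinear_matrix_mult]

text \<open>With a basis \<open>B\<close> of the range and \<open>\<phi> b v\<close> the coordinate
  of \<open>P v\<close> along \<open>b\<close>, \<open>P\<close> is the sum of the rank one maps
  sending \<open>v\<close> to \<open>\<phi> b v *s b\<close>. Each has trace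
  \<open>\<phi> b b\<close>, which is 1 because \<open>P\<close> fixes its range.\<close>

lemma idempotent_trace:
  fixes P :: "'a::field^'n^'n"
  assumes "P ** P = P"
  shows "trace P = of_nat (vec.dim (range ((*v) P)))"
proof -
  let ?R = "range ((*v) P)"
  obtain B where B: "B \<subseteq> ?R" "vec.independent B" "?R \<subseteq> vec.span B" "card B = vec.dim ?R"
    using vec.basis_exists by blast
  have fin: "finite B" using B(2) by (rule vec.finiteI_independent)
  have span: "P *v v \<in> vec.span B" for v using B(3) by auto
  define \<phi> where "\<phi> b v = vec.representation B (P *v v) b" for b v
  have lin: "Vector_Spaces.linear (*s) (*) (\<phi> b)" for b
    by (rule Vector_Spaces.linear_iff[THEN iffD2])
      (auto simp: \<phi>_def matrix_vector_right_distrib vec.scale vec.representation_add[OF B(2) span span]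
        vec.representation_scale[OF B(2) span] vec.vector_space_axioms
        vector_space_over_itself.vector_space_axioms)
  have Pb: "P *v b = b" if "b \<in> B" for b
    using B(1) that assms by (auto simp: matrix_vector_mul_assoc)
  have \<phi>b: "\<phi> b b = 1" if "b \<in> B" for b
    using that by (simp add: \<phi>_def Pb vec.representation_basis[OF B(2)])
  have expand: "\<phi> b v = (\<Sum>i\<in>UNIV. v $ i * \<phi> b (axis i 1))" for b v
  proof -
    have "\<phi> b v = \<phi> b (\<Sum>i\<in>UNIV. v $ i *s axis i 1)" by (simp add: basis_expansion)
    also have "\<dots> = (\<Sum>i\<in>UNIV. v $ i * \<phi> b (axis i 1))"
      using lin[of b] by (simp add: module_hom.sum module_hom.scale linear_iff_module_hom)
    finally show ?thesis .
  qed
  have "P $ i $ i = (\<Sum>b\<in>B. \<phi> b (axis i 1) * b $ i)" for i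
  proof -
    have "P *v axis i 1 = (\<Sum>b\<in>B. \<phi> b (axis i 1) *s b)"
      unfolding \<phi>_def using vec.sum_representation_eq[OF B(2) span fin] by simp
    moreover have "(P *v axis i 1) $ i = P $ i $ i"
      by (simp add: matrix_vector_mul_component inner_axis axis_def matrix_vector_mult_def if_distrib cong: if_cong)
    ultimately show ?thesis by simp
  qed
  then have "trace P = (\<Sum>i\<in>UNIV. \<Sum>b\<in>B. \<phi> b (axis i 1) * b $ i)" by (simp add: trace_def)
  also have "\<dots> = (\<Sum>b\<in>B. \<phi> b b)"
    by (subst sum.swap) (simp add: expand[symmetric] mult.commute)
  also have "\<dots> = of_nat (card B)" using \<phi>b by simp
  finally show ?thesis using B(4) by simp
qed

section \<open>Compact matrix groups and their representations\<close>

lemma matrix_inv_mult: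
  fixes A :: "'a::semiring_1^'n^'m"
  assumes "invertible A"
  shows "A ** matrix_inv A = mat 1" "matrix_inv A ** A = mat 1"
proof -
  have "A ** matrix_inv A = mat 1 \<and> matrix_inv A ** A = mat 1"
    using assms unfolding invertible_def matrix_inv_def by (rule someI_ex)
  then show "A ** matrix_inv A = mat 1" "matrix_inv A ** A = mat 1" by auto
qed

lemma compact_matrix_groupD:
  assumes "compact_matrix_group G"
  shows "compact G" "mat 1 \<in> G" "g \<in> G \<Longrightarrow> h \<in> G \<Longrightarrow> g ** h \<in> G"
    "g \<in> G \<Longrightarrow> matrix_inv g \<in> G"
    "g \<in> G \<Longrightarrow> g ** matrix_inv g = mat 1" "g \<in> G \<Longrightarrow> matrix_inv g ** g = mat 1"
  using assms by (auto simp: compact_matrix_group_def matrix_inv_mult)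

lemma representationD:
  assumes "representation G \<rho>"
  shows "continuous_on G \<rho>" "\<rho> (mat 1) = mat 1"
    "g \<in> G \<Longrightarrow> h \<in> G \<Longrightarrow> \<rho> (g ** h) = \<rho> g ** \<rho> h"
  using assms by (auto simp: representation_def)

lemma representation_inv:
  assumes "compact_matrix_group G" "representation G \<rho>" "g \<in> G"
  shows "\<rho> g ** \<rho> (matrix_inv g) = mat 1" "\<rho> (matrix_inv g) ** \<rho> g = mat 1"
  using assms compact_matrix_groupD[OF assms(1)] representationD[OF assms(2)] by metis+

lemma representation_bounded_mult:
  fixes \<rho> :: "complex^'m^'m \<Rightarrow> complex^'n^'n"
  assumes G: "compact_matrix_group G" and \<rho>: "representation G \<rho>"
  obtains C where "C > 0" "\<And>g (A :: complex^'k^'n). g \<in> G \<Longrightarrow> norm (\<rho> g ** A) \<le> C * norm A"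
proof -
  have "bounded (\<rho> ` G)"
    using compact_continuous_image[OF representationD(1)[OF \<rho>] compact_matrix_groupD(1)[OF G]]
    by (rule compact_imp_bounded)
  then obtain a where a: "a > 0" "\<And>g. g \<in> G \<Longrightarrow> norm (\<rho> g) \<le> a"
    by (auto simp: bounded_pos)
  obtain b where b: "b > 0" "\<And>A B. norm ((A :: complex^'n^'n) ** (B :: complex^'k^'n)) \<le> norm A * norm B * b"
    using bounded_bilinear.pos_bounded[OF bounded_bilinear_matrix_mult] by blast
  have "norm (\<rho> g ** A) \<le> a * b * norm A" if "g \<in> G" for g and A :: "complex^'k^'n"
  proof -
    have "norm (\<rho> g ** A) \<le> norm (\<rho> g) * norm A * b" by (rule b)
    also have "\<dots> \<le> a * norm A * b" using a b that by (intro mult_right_mono) auto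
    finally show ?thesis by (simp add: mult_ac)
  qed
  then show ?thesis using a b that[of "a * b"] by simp
qed

section \<open>Finite weighted averages in place of Haar measure\<close>

definition prob_weights :: "'g set \<Rightarrow> 'g set \<Rightarrow> ('g \<Rightarrow> real) \<Rightarrow> bool" where
  "prob_weights G K c \<longleftrightarrow> finite K \<and> K \<subseteq> G \<and> (\<forall>k\<in>K. 0 \<le> c k) \<and> sum c K = 1"

definition average :: "'g set \<Rightarrow> ('g \<Rightarrow> real) \<Rightarrow> ('g \<Rightarrow> 'e) \<Rightarrow> 'e::real_vector" where
  "average K c f = (\<Sum>k\<in>K. c k *\<^sub>R f k)"

text \<open>The condition is tied to one representation: finitely many points reproduce the Haar
  integral only of prescribed matrix coefficients.\<close>

definition averaging :: "'g set \<Rightarrow> 'g set \<Rightarrow> ('g \<Rightarrow> real) \<Rightarrow> ('g \<Rightarrow> complex^'n^'n) \<Rightarrow> bool" where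
  "averaging G K c \<rho> \<longleftrightarrow> (\<forall>g\<in>G. \<rho> g ** average K c \<rho> = average K c \<rho>)"

lemma average_linear: "linear f \<Longrightarrow> f (average K c h) = average K c (\<lambda>k. f (h k))"
  by (simp add: average_def linear_sum linear_scale)

lemmas linear_matrix_mult_left = bounded_linear.linear[OF bounded_bilinear.bounded_linear_right[OF bounded_bilinear_matrix_mult]]
lemmas linear_matrix_mult_right = bounded_linear.linear[OF bounded_bilinear.bounded_linear_left[OF bounded_bilinear_matrix_mult]]

lemma linear_matrix_vector: "linear (\<lambda>A. (A :: complex^'n^'m) *v v)"
  by (simp add: linear_iff vec_eq_iff matrix_vector_mult_def algebra_simps sum.distrib scaleR_sum_right)

lemma linear_trace: "linear (trace :: complex^'n^'n \<Rightarrow> complex)"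
  by (simp add: linear_iff trace_def sum.distrib scaleR_sum_right)

lemma average_cong: "(\<And>k. k \<in> K \<Longrightarrow> f k = g k) \<Longrightarrow> average K c f = average K c g"
  by (simp add: average_def cong: sum.cong)

text \<open>A vanishing weighted sum of squares says nothing at points of weight 0, hence this
  variant.\<close>

lemma average_cong_support:
  "(\<And>k. k \<in> K \<Longrightarrow> c k \<noteq> 0 \<Longrightarrow> f k = g k) \<Longrightarrow> average K c f = average K c g"
  unfolding average_def by (intro sum.cong) auto

lemma average_const: "prob_weights G K c \<Longrightarrow> average K c (\<lambda>_. x) = x"
  by (simp add: average_def prob_weights_def scaleR_left.sum[symmetric])

text \<open>Three representations are treated together because the spaces Hom(X,X), Hom(X,Y) and
  Hom(Y,Y) must later be averaged with the same weights. Left translation acts on the convex hull of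
  the image of \<open>G\<close> in the triple product, and a fixed point there is a finite convex
  combination.\<close>

lemma exists_averaging:
  fixes \<rho> :: "complex^'m^'m \<Rightarrow> complex^'n^'n" and \<sigma> :: "complex^'m^'m \<Rightarrow> complex^'k^'k"
    and \<tau> :: "complex^'m^'m \<Rightarrow> complex^'l^'l"
  assumes G: "compact_matrix_group G"
    and \<rho>: "representation G \<rho>" and \<sigma>: "representation G \<sigma>" and \<tau>: "representation G \<tau>"
  obtains K c where "prob_weights G K c" "averaging G K c \<rho>" "averaging G K c \<sigma>" "averaging G K c \<tau>"
proof -
  note G' = compact_matrix_groupD[OF G]
  define \<Phi> where "\<Phi> g = (\<rho> g, \<sigma> g, \<tau> g)" for g
  define act where "act g = (\<lambda>(A :: complex^'n^'n, B :: complex^'k^'k, C :: complex^'l^'l).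
      (\<rho> g ** A, \<sigma> g ** B, \<tau> g ** C))" for g
  obtain a1 where a1: "a1 > 0" "\<And>g (A :: complex^'n^'n). g \<in> G \<Longrightarrow> norm (\<rho> g ** A) \<le> a1 * norm A"
    using representation_bounded_mult[OF G \<rho>] by blast
  obtain a2 where a2: "a2 > 0" "\<And>g (A :: complex^'k^'k). g \<in> G \<Longrightarrow> norm (\<sigma> g ** A) \<le> a2 * norm A"
    using representation_bounded_mult[OF G \<sigma>] by blast
  obtain a3 where a3: "a3 > 0" "\<And>g (A :: complex^'l^'l). g \<in> G \<Longrightarrow> norm (\<tau> g ** A) \<le> a3 * norm A"
    using representation_bounded_mult[OF G \<tau>] by blast
  have act_mult: "act g (act h x) = act (g ** h) x" if "g \<in> G" "h \<in> G" for g h x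
    using that \<rho> \<sigma> \<tau>
    by (cases x) (simp add: act_def representation_def matrix_mul_assoc)
  have act_one: "act (mat 1) x = x" for x
    using \<rho> \<sigma> \<tau> by (cases x) (simp add: act_def representation_def)
  have act_lin: "linear (act g)" for g
    by (simp add: act_def linear_iff split_beta
        linear_add[OF linear_matrix_mult_left] linear_scale[OF linear_matrix_mult_left])
  have act_\<Phi>: "act g (\<Phi> h) = \<Phi> (g ** h)" if "g \<in> G" "h \<in> G" for g h
    using that \<rho> \<sigma> \<tau> by (simp add: act_def \<Phi>_def representation_def)
  have upper: "norm (act g x) \<le> (a1 + a2 + a3) * norm x" if g: "g \<in> G" for g x
  proof -
    obtain A B C where x: "x = (A, B, C)" by (cases x)
    have n: "norm A \<le> norm x" "norm B \<le> norm x" "norm C \<le> norm x"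
      unfolding x using norm_fst_le[of A "(B, C)"] norm_snd_le[of "(B, C)" A]
        norm_fst_le[of B C] norm_snd_le[of C B] by auto
    have "norm (act g x) \<le> norm (\<rho> g ** A) + (norm (\<sigma> g ** B) + norm (\<tau> g ** C))"
      unfolding x act_def prod.case
      by (rule order_trans[OF norm_Pair_le add_left_mono[OF norm_Pair_le]])
    also have "\<dots> \<le> a1 * norm A + (a2 * norm B + a3 * norm C)"
      using a1 a2 a3 g by (intro add_mono) auto
    also have "\<dots> \<le> a1 * norm x + (a2 * norm x + a3 * norm x)"
      using n a1 a2 a3 by (intro add_mono mult_left_mono) auto
    finally show ?thesis by (simp add: algebra_simps)
  qed
  have "\<exists>x\<in>convex hull (\<Phi> ` G). \<forall>f\<in>act ` G. f x = x"
  proof (rule bounded_linear_group_fixed_point)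
    show "act ` G \<noteq> {}" using G' by auto
    show "linear f" if "f \<in> act ` G" for f using that act_lin by auto
    show "f \<circ> g \<in> act ` G" if "f \<in> act ` G" "g \<in> act ` G" for f g
    proof -
      obtain a b where ab: "a \<in> G" "b \<in> G" "f = act a" "g = act b" using \<open>f \<in> _\<close> \<open>g \<in> _\<close> by auto
      have "f \<circ> g = act (a ** b)" using ab by (intro ext) (simp add: act_mult)
      then show ?thesis using ab G' by blast
    qed
    show "0 < a1 + a2 + a3" using a1 a2 a3 by simp
    show "norm (f x) \<le> (a1 + a2 + a3) * norm x" if "f \<in> act ` G" for f x
      using that upper by blast
    show "norm x \<le> (a1 + a2 + a3) * norm (f x)" if f: "f \<in> act ` G" for f x
    proof -
      obtain g where g: "g \<in> G" "f = act g" using f by blast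
      \<comment> \<open>The bound from below is the bound from above for the inverse
        element.\<close>
      have "x = act (matrix_inv g) (act g x)" using G' g act_one by (simp add: act_mult)
      then show ?thesis using upper[of "matrix_inv g" "act g x"] g G' by simp
    qed
    have "continuous_on G \<Phi>"
      unfolding \<Phi>_def using \<rho> \<sigma> \<tau> by (intro continuous_intros) (auto simp: representation_def)
    then show "compact (convex hull (\<Phi> ` G))"
      using G' by (intro compact_convex_hull compact_continuous_image)
    show "convex (convex hull (\<Phi> ` G))" by simp
    show "convex hull (\<Phi> ` G) \<noteq> {}" using G' by auto
    show "f x \<in> convex hull (\<Phi> ` G)" if f: "f \<in> act ` G" and x: "x \<in> convex hull (\<Phi> ` G)" for f x
    proof -
      obtain g where g: "g \<in> G" "f = act g" using f by blast
      have "f x \<in> act g ` (convex hull (\<Phi> ` G))" using x g(2) by blast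
      also have "\<dots> = convex hull (act g ` (\<Phi> ` G))"
        by (rule convex_hull_linear_image[OF act_lin])
      also have "\<dots> \<subseteq> convex hull (\<Phi> ` G)"
        using g act_\<Phi> G' by (intro hull_mono) auto
      finally show ?thesis .
    qed
  qed
  then obtain x where x: "x \<in> convex hull (\<Phi> ` G)" "\<And>g. g \<in> G \<Longrightarrow> act g x = x" by auto
  then obtain S u where S: "finite S" "S \<subseteq> \<Phi> ` G" "\<forall>s\<in>S. 0 \<le> u s" "sum u S = 1"
    "(\<Sum>s\<in>S. u s *\<^sub>R s) = x"
    unfolding convex_hull_explicit by blast
  \<comment> \<open>One group element is chosen above each point of \<open>S\<close>, and it
    inherits the weight of that point.\<close>
  define K where "K = inv_into G \<Phi> ` S"
  define c where "c = u \<circ> \<Phi>"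
  have inj: "inj_on (inv_into G \<Phi>) S" using S(2) by (rule inj_on_inv_into)
  have inv: "\<Phi> (inv_into G \<Phi> s) = s" if "s \<in> S" for s
    using that S(2) by (intro f_inv_into_f) auto
  have "sum c K = 1" unfolding K_def c_def using inj S(4) inv by (simp add: sum.reindex)
  then have K: "prob_weights G K c"
    unfolding prob_weights_def K_def c_def using S inv by (auto intro: inv_into_into)
  have "average K c \<Phi> = x"
    unfolding average_def K_def c_def using inj S(5) inv by (simp add: sum.reindex)
  moreover have "average K c \<Phi> = (average K c \<rho>, average K c \<sigma>, average K c \<tau>)"
    by (simp add: average_def \<Phi>_def prod_eq_iff fst_sum snd_sum)
  ultimately have "act g (average K c \<rho>, average K c \<sigma>, average K c \<tau>) =
      (average K c \<rho>, average K c \<sigma>, average K c \<tau>)" if "g \<in> G" for g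
    using x(2) that by simp
  then have "averaging G K c \<rho>" "averaging G K c \<sigma>" "averaging G K c \<tau>"
    by (auto simp: averaging_def act_def)
  with K show ?thesis by (rule that)
qed

lemma average_idempotent:
  fixes \<rho> :: "complex^'m^'m \<Rightarrow> complex^'n^'n"
  assumes K: "prob_weights G K c" and av: "averaging G K c \<rho>"
  shows "average K c \<rho> ** average K c \<rho> = average K c \<rho>"
proof -
  have "average K c \<rho> ** average K c \<rho> = average K c (\<lambda>k. \<rho> k ** average K c \<rho>)"
    by (rule average_linear[OF linear_matrix_mult_right])
  also have "\<dots> = average K c (\<lambda>k. average K c \<rho>)"
    using K av by (intro average_cong) (auto simp: prob_weights_def averaging_def)
  finally show ?thesis using average_const[OF K] by simp
qed

text \<open>The averaged matrix \<open>E\<close> takes values in the invariants and, the weights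
  having sum 1, fixes every invariant. So it is a projection onto them, and its trace is its
  rank.\<close>

lemma averaging_fixed_dim:
  fixes \<rho> :: "complex^'m^'m \<Rightarrow> complex^'n^'n"
  assumes K: "prob_weights G K c" and av: "averaging G K c \<rho>"
  shows "of_nat (vec.dim (zero_weight_space G \<rho>)) = average K c (\<lambda>k. trace (\<rho> k))"
proof -
  define E where "E = average K c \<rho>"
  have E: "\<rho> g ** E = E" if "g \<in> G" for g using av that by (simp add: averaging_def E_def)
  have KG: "K \<subseteq> G" using K by (simp add: prob_weights_def)
  have EE: "E ** E = E" unfolding E_def by (rule average_idempotent[OF K av])
  have "range ((*v) E) = zero_weight_space G \<rho>"
  proof (intro equalityI subsetI)
    fix v assume "v \<in> range ((*v) E)"
    then show "v \<in> zero_weight_space G \<rho>"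
      using E by (auto simp: zero_weight_space_def matrix_vector_mul_assoc)
  next
    fix v assume v: "v \<in> zero_weight_space G \<rho>"
    have "E *v v = average K c (\<lambda>k. \<rho> k *v v)"
      unfolding E_def by (rule average_linear[OF linear_matrix_vector])
    also have "\<dots> = average K c (\<lambda>k. v)"
      using v KG by (intro average_cong) (auto simp: zero_weight_space_def)
    finally have "E *v v = v" using average_const[OF K] by simp
    then show "v \<in> range ((*v) E)" by (metis rangeI)
  qed
  then have "of_nat (vec.dim (zero_weight_space G \<rho>)) = trace E"
    using idempotent_trace[OF EE] by simp
  also have "\<dots> = average K c (\<lambda>k. trace (\<rho> k))"
    unfolding E_def by (rule average_linear[OF linear_trace])
  finally show ?thesis .
qed

text \<open>Common weights express both dimensions as averages of the characters. The third place in
  \<open>exists_averaging\<close> is filled by repeating \<open>\<sigma>\<close>.\<close>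

lemma fixed_dim_cong_trace:
  fixes \<rho> :: "complex^'m^'m \<Rightarrow> complex^'n^'n" and \<sigma> :: "complex^'m^'m \<Rightarrow> complex^'k^'k"
  assumes "compact_matrix_group G" "representation G \<rho>" "representation G \<sigma>"
    and "\<And>g. g \<in> G \<Longrightarrow> trace (\<rho> g) = trace (\<sigma> g)"
  shows "vec.dim (zero_weight_space G \<rho>) = vec.dim (zero_weight_space G \<sigma>)"
proof -
  obtain K c where K: "prob_weights G K c" "averaging G K c \<rho>" "averaging G K c \<sigma>"
    using exists_averaging[OF assms(1-3,3)] by metis
  have "average K c (\<lambda>k. trace (\<rho> k)) = average K c (\<lambda>k. trace (\<sigma> k))"
    using K(1) assms(4) by (intro average_cong) (auto simp: prob_weights_def)
  then show ?thesis
    using averaging_fixed_dim[OF K(1,2)] averaging_fixed_dim[OF K(1,3)] of_nat_eq_iff[where 'a = complex]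
    by metis
qed

section \<open>Invariant Hermitian forms\<close>

lemma trace_ctranspose: "trace (ctranspose A) = cnj (trace A)"
  by (simp add: trace_def ctranspose_def)

lemma ctranspose_mult: "ctranspose (A ** B) = ctranspose B ** ctranspose A"
  by (simp add: ctranspose_def matrix_matrix_mult_def vec_eq_iff mult.commute)

text \<open>Here the inner product is the real one, that is, the real part of the Hermitian product;
  this suffices to test positivity.\<close>

lemma inner_ctranspose: "v \<bullet> (ctranspose M *v w) = (M *v v) \<bullet> w"
proof -
  have c: "a \<bullet> b = Re (cnj a * b)" for a b :: complex by (simp add: inner_complex_def)
  have "(\<Sum>i\<in>UNIV. cnj (v $ i) * (\<Sum>j\<in>UNIV. cnj (M $ j $ i) * w $ j)) =
      (\<Sum>j\<in>UNIV. cnj (\<Sum>i\<in>UNIV. M $ j $ i * v $ i) * w $ j)"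
    by (simp add: sum_distrib_left sum_distrib_right mult_ac) (rule sum.swap)
  then have "Re (\<Sum>i\<in>UNIV. cnj (v $ i) * (\<Sum>j\<in>UNIV. cnj (M $ j $ i) * w $ j)) =
      Re (\<Sum>j\<in>UNIV. cnj (\<Sum>i\<in>UNIV. M $ j $ i * v $ i) * w $ j)" by (rule arg_cong)
  then show ?thesis
    by (simp only: inner_vec_def c Re_sum matrix_vector_mult_def ctranspose_def vec_lambda_beta)
qed

text \<open>\<open>G\<close> acts on matrices by pulling back forms, and the fixed point theorem
  applies to the convex hull of the orbit of the standard form. Positive definiteness is a convex
  condition, so the fixed form inherits it and is invertible.\<close>

lemma invariant_hermitian_form:
  fixes \<rho> :: "complex^'m^'m \<Rightarrow> complex^'n^'n"
  assumes G: "compact_matrix_group G" and \<rho>: "representation G \<rho>"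
  obtains H where "invertible H" "\<And>g. g \<in> G \<Longrightarrow> ctranspose (\<rho> g) ** H ** \<rho> g = H"
proof -
  note G' = compact_matrix_groupD[OF G]
  define \<Phi> where "\<Phi> g = ctranspose (\<rho> g) ** \<rho> g" for g
  define act where "act g A = ctranspose (\<rho> g) ** A ** \<rho> g" for g and A :: "complex^'n^'n"
  have cont_ct: "continuous_on G (\<lambda>g. ctranspose (\<rho> g))"
    unfolding ctranspose_def using representationD(1)[OF \<rho>] by (intro continuous_intros)
  obtain b where b: "b > 0" "\<And>A B. norm ((A :: complex^'n^'n) ** (B :: complex^'n^'n)) \<le> norm A * norm B * b"
    using bounded_bilinear.pos_bounded[OF bounded_bilinear_matrix_mult] by blast
  have "bounded (\<rho> ` G)" "bounded ((\<lambda>g. ctranspose (\<rho> g)) ` G)"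
    using compact_continuous_image cont_ct representationD(1)[OF \<rho>] G'(1) compact_imp_bounded by blast+
  then obtain a1 a2 where a: "a1 > 0" "\<And>g. g \<in> G \<Longrightarrow> norm (\<rho> g) \<le> a1"
    "a2 > 0" "\<And>g. g \<in> G \<Longrightarrow> norm (ctranspose (\<rho> g)) \<le> a2"
    by (auto simp: bounded_pos)
  define C where "C = a2 * b * (a1 * b)"
  \<comment> \<open>Pulling back reverses products, so this is a right action.\<close>
  have act_mult: "act g (act h x) = act (h ** g) x" if "g \<in> G" "h \<in> G" for g h x
    using that \<rho> by (simp add: act_def representation_def matrix_mul_assoc ctranspose_mult)
  have act_one: "act (mat 1) x = x" for x
  proof -
    have "ctranspose (mat 1) = (mat 1 :: complex^'n^'n)"
      by (auto simp: ctranspose_def mat_def vec_eq_iff)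
    then show ?thesis using \<rho> by (simp add: act_def representation_def)
  qed
  have act_lin: "linear (act g)" for g
    unfolding act_def
    using linear_compose[OF linear_matrix_mult_left linear_matrix_mult_right] by (simp add: o_def)
  have act_\<Phi>: "act g (\<Phi> h) = \<Phi> (h ** g)" if "g \<in> G" "h \<in> G" for g h
    using that \<rho> by (simp add: act_def \<Phi>_def representation_def matrix_mul_assoc ctranspose_mult)
  have upper: "norm (act g x) \<le> C * norm x" if g: "g \<in> G" for g x
  proof -
    have "norm (act g x) \<le> norm (ctranspose (\<rho> g) ** x) * norm (\<rho> g) * b"
      unfolding act_def by (rule b)
    also have "\<dots> \<le> (norm (ctranspose (\<rho> g)) * norm x * b) * norm (\<rho> g) * b"
      using b by (intro mult_right_mono) auto
    also have "\<dots> \<le> (a2 * norm x * b) * a1 * b"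
      using a b g by (intro mult_right_mono mult_mono) auto
    finally show ?thesis by (simp add: C_def mult_ac)
  qed
  have "\<exists>x\<in>convex hull (\<Phi> ` G). \<forall>f\<in>act ` G. f x = x"
  proof (rule bounded_linear_group_fixed_point)
    show "act ` G \<noteq> {}" using G' by auto
    show "linear f" if "f \<in> act ` G" for f using that act_lin by auto
    show "f \<circ> g \<in> act ` G" if "f \<in> act ` G" "g \<in> act ` G" for f g
    proof -
      obtain a b where ab: "a \<in> G" "b \<in> G" "f = act a" "g = act b" using \<open>f \<in> _\<close> \<open>g \<in> _\<close> by auto
      have "f \<circ> g = act (b ** a)" using ab by (intro ext) (simp add: act_mult)
      then show ?thesis using ab G' by blast
    qed
    show "0 < C" using a b by (simp add: C_def)
    show "norm (f x) \<le> C * norm x" if "f \<in> act ` G" for f x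
      using that upper by blast
    show "norm x \<le> C * norm (f x)" if f: "f \<in> act ` G" for f x
    proof -
      obtain g where g: "g \<in> G" "f = act g" using f by blast
      have "x = act (matrix_inv g) (act g x)" using G' g act_one by (simp add: act_mult)
      then show ?thesis using upper[of "matrix_inv g" "act g x"] g G' by simp
    qed
    have "continuous_on G \<Phi>"
      unfolding \<Phi>_def using cont_ct representationD(1)[OF \<rho>] by (intro continuous_on_matrix_mult)
    then show "compact (convex hull (\<Phi> ` G))"
      using G' by (intro compact_convex_hull compact_continuous_image)
    show "convex (convex hull (\<Phi> ` G))" by simp
    show "convex hull (\<Phi> ` G) \<noteq> {}" using G' by auto
    show "f x \<in> convex hull (\<Phi> ` G)" if f: "f \<in> act ` G" and x: "x \<in> convex hull (\<Phi> ` G)" for f x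
    proof -
      obtain g where g: "g \<in> G" "f = act g" using f by blast
      have "f x \<in> act g ` (convex hull (\<Phi> ` G))" using x g(2) by blast
      also have "\<dots> = convex hull (act g ` (\<Phi> ` G))"
        by (rule convex_hull_linear_image[OF act_lin])
      also have "\<dots> \<subseteq> convex hull (\<Phi> ` G)"
        using g act_\<Phi> G' by (intro hull_mono) auto
      finally show ?thesis .
    qed
  qed
  then obtain H where H: "H \<in> convex hull (\<Phi> ` G)" "\<And>g. g \<in> G \<Longrightarrow> act g H = H" by auto
  \<comment> \<open>For fixed \<open>v\<close> the positive values form a half-space; it contains
    every \<open>\<Phi> g\<close> since \<open>\<rho> g\<close> is injective, hence the whole
    hull.\<close>
  have pos: "0 < v \<bullet> (H *v v)" if v: "v \<noteq> 0" for v
  proof -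
    have "linear (\<lambda>A. v \<bullet> (A *v v))"
      using linear_compose[OF linear_matrix_vector bounded_linear.linear[OF bounded_linear_inner_right]]
      by (simp add: o_def)
    then have "convex {A. 0 < v \<bullet> (A *v v)}"
      using convex_linear_vimage[of "\<lambda>A. v \<bullet> (A *v v)" "{0<..}"] by (simp add: vimage_def)
    moreover have "0 < v \<bullet> (\<Phi> g *v v)" if g: "g \<in> G" for g
    proof -
      have "\<rho> g *v v \<noteq> 0"
        using v representation_inv(2)[OF G \<rho> g]
        by (metis matrix_vector_mul_assoc matrix_vector_mul_lid matrix_vector_mult_0_right)
      then show ?thesis by (simp add: \<Phi>_def matrix_vector_mul_assoc[symmetric] inner_ctranspose)
    qed
    ultimately have "convex hull (\<Phi> ` G) \<subseteq> {A. 0 < v \<bullet> (A *v v)}"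
      by (intro hull_minimal) auto
    then show ?thesis using H(1) by auto
  qed
  then have "\<forall>v. H *v v = 0 \<longrightarrow> v = 0" by (metis inner_zero_right less_irrefl)
  then have "invertible H" by (simp add: invertible_left_inverse matrix_left_invertible_ker)
  then show ?thesis using H(2) by (intro that) (auto simp: act_def)
qed

text \<open>The invariant form conjugates \<open>\<rho> (matrix_inv g)\<close> to the adjoint
  \<open>ctranspose (\<rho> g)\<close>.\<close>

lemma trace_representation_inv:
  assumes "compact_matrix_group G" "representation G \<rho>" "g \<in> G"
  shows "trace (\<rho> (matrix_inv g)) = cnj (trace (\<rho> g))"
proof -
  obtain H where H: "invertible H" "\<And>g. g \<in> G \<Longrightarrow> ctranspose (\<rho> g) ** H ** \<rho> g = H"
    using invariant_hermitian_form[OF assms(1,2)] by blast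
  have *: "H ** \<rho> (matrix_inv g) = ctranspose (\<rho> g) ** H"
    using arg_cong[OF H(2)[OF assms(3)], of "\<lambda>A. A ** \<rho> (matrix_inv g)"]
      representation_inv(1)[OF assms] by (simp add: matrix_mul_assoc[symmetric])
  have "\<rho> (matrix_inv g) = matrix_inv H ** (ctranspose (\<rho> g) ** H)"
    unfolding *[symmetric] using matrix_inv_mult(2)[OF H(1)] by (simp add: matrix_mul_assoc)
  then have "trace (\<rho> (matrix_inv g)) = trace (ctranspose (\<rho> g) ** H ** matrix_inv H)"
    by (simp only: trace_mul_sym[of "matrix_inv H"])
  then show ?thesis
    using matrix_inv_mult(1)[OF H(1)] by (simp add: matrix_mul_assoc[symmetric] trace_ctranspose)
qed

section \<open>Intertwiners and characters\<close>

text \<open>The matrix operation behind \<open>tensor_rep\<close>, isolated because it is also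
  applied to projections and to products with them.\<close>

definition kron :: "complex^'n^'n \<Rightarrow> complex^'k^'k \<Rightarrow> complex^('n \<times> 'k)^('n \<times> 'k)" where
  "kron A B = (\<chi> p q. A $ fst p $ fst q * B $ snd p $ snd q)"

text \<open>A vector indexed by \<open>'n \<times> 'k\<close> is read as the matrix of a linear map \<open>complex^'n \<Rightarrow> complex^'k\<close>,
  so that the invariants of \<open>hom_rep X Y\<close> below are the intertwiners from \<open>X\<close> to \<open>Y\<close>.\<close>

definition mat_of :: "complex^('n \<times> 'k) \<Rightarrow> complex^'n^'k" where
  "mat_of v = (\<chi> b a. v $ (a, b))"

definition vec_of :: "complex^'n^'k \<Rightarrow> complex^('n \<times> 'k)" where
  "vec_of A = (\<chi> p. A $ snd p $ fst p)"

abbreviation hom_rep ::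
    "(complex^'m^'m \<Rightarrow> complex^'n^'n) \<Rightarrow> (complex^'m^'m \<Rightarrow> complex^'k^'k) \<Rightarrow>
     complex^'m^'m \<Rightarrow> complex^('n \<times> 'k)^('n \<times> 'k)" where
  "hom_rep X Y \<equiv> tensor_rep (dual_rep X) Y"

lemma tensor_rep_kron: "tensor_rep \<rho> \<sigma> g = kron (\<rho> g) (\<sigma> g)"
  by (simp add: tensor_rep_def kron_def)

lemma kron_mult: "kron A B ** kron A' B' = kron (A ** A') (B ** B')"
  unfolding kron_def matrix_matrix_mult_def vec_eq_iff
  by (simp add: sum_product UNIV_Times_UNIV[symmetric] sum.cartesian_product' mult_ac
      del: UNIV_Times_UNIV)

lemma trace_kron: "trace (kron A B) = trace A * trace B"
  unfolding kron_def trace_def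
  by (simp add: sum_product UNIV_Times_UNIV[symmetric] sum.cartesian_product' del: UNIV_Times_UNIV)

lemma kron_one: "kron (mat 1) (mat 1) = mat 1"
  by (auto simp: kron_def mat_def vec_eq_iff prod_eq_iff)

lemma mat_of_vec_of [simp]: "mat_of (vec_of A) = A" and vec_of_mat_of [simp]: "vec_of (mat_of v) = v"
  by (simp_all add: mat_of_def vec_of_def vec_eq_iff)

lemma linear_vec_of: "linear vec_of"
  by (simp add: linear_iff vec_of_def vec_eq_iff)

lemma kron_vec_of: "kron A B *v vec_of M = vec_of (B ** M ** transpose A)"
  unfolding kron_def vec_of_def matrix_matrix_mult_def matrix_vector_mult_def vec_eq_iff transpose_def
  by (simp add: sum_distrib_left sum_distrib_right UNIV_Times_UNIV[symmetric] sum.cartesian_product' mult_ac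
      del: UNIV_Times_UNIV)

section \<open>Dual, tensor product and Hom representations\<close>

text \<open>The graph \<open>S\<close> of inversion is closed in \<open>G \<times> G\<close>, hence
  compact. Its first projection is a continuous bijection onto \<open>G\<close> from a compact
  space, so the inverse of that projection is continuous.\<close>

lemma continuous_on_matrix_inv:
  assumes "compact_matrix_group G"
  shows "continuous_on G matrix_inv"
proof -
  note G' = compact_matrix_groupD[OF assms]
  define S where "S = {p \<in> G \<times> G. fst p ** snd p = mat 1}"
  have "continuous_on (G \<times> G) (\<lambda>p. fst p ** snd p)"
    by (rule continuous_on_matrix_mult[OF continuous_on_fst[OF continuous_on_id] continuous_on_snd[OF continuous_on_id]])
  moreover have "closed (G \<times> G)" using G'(1) by (simp add: compact_imp_closed compact_Times)
  ultimately have "closed S"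
    unfolding S_def by (rule continuous_closed_preimage_constant)
  then have "compact ((G \<times> G) \<inter> S)" by (intro compact_Int_closed compact_Times G'(1))
  moreover have "(G \<times> G) \<inter> S = S" by (auto simp: S_def)
  ultimately have "compact S" by simp
  moreover have "(fst p, matrix_inv (fst p)) = p" if "p \<in> S" for p
  proof -
    have p: "fst p \<in> G" "fst p ** snd p = mat 1" using that by (auto simp: S_def)
    have "matrix_inv (fst p) ** fst p ** snd p = matrix_inv (fst p)"
      by (simp add: p(2) matrix_mul_assoc[symmetric])
    then have "snd p = matrix_inv (fst p)" using G'(6)[OF p(1)] by simp
    then show ?thesis by (simp add: prod_eq_iff)
  qed
  ultimately have "continuous_on (fst ` S) (\<lambda>g. (g, matrix_inv g))"
    by (intro continuous_on_inv[OF continuous_on_fst[OF continuous_on_id]]) auto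
  moreover have "fst ` S = G"
  proof
    show "fst ` S \<subseteq> G" by (auto simp: S_def)
    show "G \<subseteq> fst ` S"
      using G'(4,5) by (auto simp: S_def intro!: image_eqI[where x = "(g, matrix_inv g)" for g])
  qed
  ultimately have "continuous_on G (\<lambda>g. (g, matrix_inv g))" by simp
  from continuous_on_snd[OF this] show ?thesis by simp
qed

lemma matrix_inv_prod:
  fixes A B :: "'a::field^'n^'n"
  assumes "invertible A" "invertible B"
  shows "matrix_inv (A ** B) = matrix_inv B ** matrix_inv A"
proof -
  have "(matrix_inv B ** matrix_inv A) ** (A ** B) = matrix_inv B ** (matrix_inv A ** A) ** B"
    by (simp add: matrix_mul_assoc)
  then have *: "(matrix_inv B ** matrix_inv A) ** (A ** B) = mat 1"
    using assms by (simp add: matrix_inv_mult)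
  have "invertible (A ** B)" using assms by (rule invertible_mult)
  have "(matrix_inv B ** matrix_inv A) ** (A ** B) ** matrix_inv (A ** B) = matrix_inv (A ** B)"
    by (simp add: *)
  then show ?thesis
    using matrix_inv_mult(1)[OF \<open>invertible (A ** B)\<close>] by (simp add: matrix_mul_assoc[symmetric])
qed

lemma representation_dual:
  fixes G :: "(complex^'m^'m) set"
  assumes G: "compact_matrix_group G" and \<rho>: "representation G \<rho>"
  shows "representation G (dual_rep \<rho>)"
proof -
  note G' = compact_matrix_groupD[OF G]
  have "continuous_on G (\<lambda>g. \<rho> (matrix_inv g))"
    using continuous_on_matrix_inv[OF G] representationD(1)[OF \<rho>] G'(4)
    by (intro continuous_on_compose2[of G \<rho> G matrix_inv]) auto
  then have "continuous_on G (dual_rep \<rho>)"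
    unfolding dual_rep_def transpose_def by (intro continuous_intros)
  moreover have "matrix_inv (mat 1 :: complex^'m^'m) = mat 1"
    using G'(5)[OF G'(2)] by simp
  then have "dual_rep \<rho> (mat 1) = mat 1"
    using representationD(2)[OF \<rho>] by (simp add: dual_rep_def)
  moreover have "dual_rep \<rho> (g ** h) = dual_rep \<rho> g ** dual_rep \<rho> h" if "g \<in> G" "h \<in> G" for g h
  proof -
    have "invertible g" "invertible h" using G that by (auto simp: compact_matrix_group_def)
    then show ?thesis using that G' representationD(3)[OF \<rho>]
      by (simp add: dual_rep_def matrix_inv_prod matrix_transpose_mul)
  qed
  ultimately show ?thesis by (simp add: representation_def)
qed

lemma representation_tensor:
  assumes "representation G \<rho>" "representation G \<sigma>"
  shows "representation G (tensor_rep \<rho> \<sigma>)"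
proof -
  have "continuous_on G (tensor_rep \<rho> \<sigma>)"
    unfolding tensor_rep_def by (intro continuous_intros representationD(1)[OF assms(1)] representationD(1)[OF assms(2)])
  then show ?thesis
    using assms by (simp add: representation_def tensor_rep_kron kron_mult kron_one)
qed

lemma representation_hom:
  "compact_matrix_group G \<Longrightarrow> representation G X \<Longrightarrow> representation G Y \<Longrightarrow> representation G (hom_rep X Y)"
  by (intro representation_tensor representation_dual)

lemma trace_transpose: "trace (transpose A) = trace A"
  by (simp add: trace_def transpose_def)

lemma trace_tensor_rep: "trace (tensor_rep \<rho> \<sigma> g) = trace (\<rho> g) * trace (\<sigma> g)"
  by (simp add: tensor_rep_kron trace_kron)

lemma trace_dual_rep:
  assumes "compact_matrix_group G" "representation G X" "g \<in> G"
  shows "trace (dual_rep X g) = cnj (trace (X g))"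
  using trace_representation_inv[OF assms] by (simp add: dual_rep_def trace_transpose)

lemma trace_hom_rep:
  assumes "compact_matrix_group G" "representation G X" "g \<in> G"
  shows "trace (hom_rep X Y g) = cnj (trace (X g)) * trace (Y g)"
  by (simp add: trace_tensor_rep trace_dual_rep[OF assms])

text \<open>The transpose built into \<open>dual_rep\<close> cancels the one produced by
  \<open>kron_vec_of\<close>.\<close>

lemma hom_rep_vec_of: "hom_rep X Y g *v vec_of A = vec_of (Y g ** A ** X (matrix_inv g))"
  by (simp add: tensor_rep_kron kron_vec_of dual_rep_def transpose_transpose)

section \<open>Equivariant maps obtained by averaging, and isomorphism from equal characters\<close>

text \<open>\<open>vec_of B\<close> is the image of \<open>vec_of A\<close> under the averaged
  \<open>hom_rep X Y\<close>, hence invariant, and invariance there means that \<open>B\<close> is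
  equivariant.\<close>

lemma averaging_intertwines:
  fixes A :: "complex^'n^'k"
  assumes G: "compact_matrix_group G" and X: "representation G X" and av: "averaging G K c (hom_rep X Y)"
    and g: "g \<in> G"
  defines "B \<equiv> average K c (\<lambda>k. Y k ** A ** X (matrix_inv k))"
  shows "B ** X g = Y g ** B"
proof -
  have "vec_of B = average K c (hom_rep X Y) *v vec_of A"
    unfolding B_def average_linear[OF linear_vec_of] average_linear[OF linear_matrix_vector]
    by (simp add: hom_rep_vec_of)
  moreover have "hom_rep X Y g *v (average K c (hom_rep X Y) *v vec_of A) = average K c (hom_rep X Y) *v vec_of A"
    using av g by (simp add: averaging_def matrix_vector_mul_assoc)
  ultimately have "vec_of (Y g ** B ** X (matrix_inv g)) = vec_of B"
    by (simp add: hom_rep_vec_of[symmetric])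
  from arg_cong[OF this, of mat_of] have "Y g ** B ** X (matrix_inv g) = B" by simp
  then have "B ** X g = Y g ** B ** X (matrix_inv g) ** X g" by simp
  then show ?thesis
    using representation_inv(2)[OF G X g] by (simp add: matrix_mul_assoc[symmetric])
qed

lemma matrix_mult_diff_distrib:
  fixes A :: "complex^'n^'m"
  shows "A ** (B - C) = A ** B - A ** C" "(B - C) ** D = B ** D - C ** (D :: complex^'k^'l)"
  by (rule linear_diff[OF linear_matrix_mult_left], rule linear_diff[OF linear_matrix_mult_right])

text \<open>The average in the last hypothesis is the dimension of the space of equivariant \<open>A\<close> with
  \<open>P A P = A\<close>, and \<open>P\<close> is such an \<open>A\<close>.\<close>

lemma equivariant_idempotent_eq_0:
  fixes X :: "complex^'m^'m \<Rightarrow> complex^'n^'n"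
  assumes K: "prob_weights G K c" and av: "averaging G K c (hom_rep X X)"
    and G: "compact_matrix_group G" and X: "representation G X"
    and P: "P ** P = P" "\<And>g. g \<in> G \<Longrightarrow> P ** X g = X g ** P"
    and zero: "average K c (\<lambda>k. trace (X k ** P) * trace (P ** X (matrix_inv k))) = 0"
  shows "P = 0"
proof -
  have KG: "K \<subseteq> G" using K by (simp add: prob_weights_def)
  define E where "E = average K c (hom_rep X X)"
  \<comment> \<open>Under \<open>vec_of\<close>, \<open>D\<close> is the projection
    \<open>A \<mapsto> P A P\<close>. It commutes with the projection \<open>E\<close> onto the
    equivariant maps, so the product \<open>S\<close> is again a projection; its trace is the
    average assumed to vanish.\<close>
  define D where "D = kron (transpose P) P"
  define S where "S = average K c (\<lambda>k. kron (transpose (P ** X (matrix_inv k))) (X k ** P))"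
  have inv: "P ** X (matrix_inv k) = X (matrix_inv k) ** P" if "k \<in> K" for k
    using that KG P(2) compact_matrix_groupD(4)[OF G] by auto
  have ED: "E ** D = S"
    unfolding E_def S_def average_linear[OF linear_matrix_mult_right]
  proof (rule average_cong)
    fix k assume "k \<in> K"
    then show "hom_rep X X k ** D = kron (transpose (P ** X (matrix_inv k))) (X k ** P)"
      by (simp add: D_def tensor_rep_kron dual_rep_def kron_mult matrix_transpose_mul)
  qed
  have DE: "D ** E = S"
    unfolding E_def S_def average_linear[OF linear_matrix_mult_left]
  proof (rule average_cong)
    fix k assume k: "k \<in> K"
    then have "P ** X k = X k ** P" using KG P(2) by auto
    then show "D ** hom_rep X X k = kron (transpose (P ** X (matrix_inv k))) (X k ** P)"
      by (simp add: inv[OF k] D_def tensor_rep_kron dual_rep_def kron_mult matrix_transpose_mul)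
  qed
  have D2: "D ** D = D"
    by (simp add: D_def kron_mult matrix_transpose_mul[symmetric] P(1))
  have "S ** S = (D ** E) ** (E ** D)" by (simp add: ED DE)
  also have "\<dots> = D ** (E ** E) ** D" by (simp add: matrix_mul_assoc)
  also have "\<dots> = S ** D" using average_idempotent[OF K av] by (simp add: E_def[symmetric] DE)
  also have "\<dots> = E ** (D ** D)" by (simp add: ED[symmetric] matrix_mul_assoc)
  finally have "S ** S = S" by (simp add: D2 ED)
  moreover have "trace S = average K c (\<lambda>k. trace (X k ** P) * trace (P ** X (matrix_inv k)))"
    unfolding S_def average_linear[OF linear_trace] by (simp add: trace_kron trace_transpose mult.commute)
  ultimately have "vec.dim (range ((*v) S)) = 0"
    using idempotent_trace[of S] zero by simp
  then have "S *v vec_of P = 0" by (auto simp: vec.dim_eq_0)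
  \<comment> \<open>\<open>P\<close> is equivariant and equals \<open>P P P\<close>, so
    \<open>S\<close> fixes it.\<close>
  moreover have "S *v vec_of P = average K c (\<lambda>k. vec_of P)"
    unfolding S_def average_linear[OF linear_matrix_vector]
  proof (rule average_cong)
    fix k assume k: "k \<in> K"
    have "(X k ** P) ** P ** (P ** X (matrix_inv k)) = X k ** ((P ** P) ** P) ** X (matrix_inv k)"
      by (simp only: matrix_mul_assoc)
    also have "\<dots> = P ** (X k ** X (matrix_inv k))"
      using k KG P by (auto simp: matrix_mul_assoc)
    also have "\<dots> = P" using representation_inv(1)[OF G X] k KG by auto
    finally show "kron (transpose (P ** X (matrix_inv k))) (X k ** P) *v vec_of P = vec_of P"
      by (simp add: kron_vec_of transpose_transpose)
  qed
  ultimately have "vec_of P = 0" using average_const[OF K, of "vec_of P"] by simp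
  then have "mat_of (vec_of P) = 0" by (simp add: mat_of_def vec_eq_iff)
  then show "P = 0" by simp
qed

text \<open>\<open>R\<close> comes from a linear choice of preimages on the range of
  \<open>F\<close>.\<close>

lemma exists_generalized_inverse:
  fixes F :: "'a::field^'n^'k"
  shows "\<exists>R. F ** R ** F = F"
proof -
  have lin: "Vector_Spaces.linear (*s) (*s) ((*v) F)" by (rule matrix_vector_mul_linear_gen)
  obtain g where g: "Vector_Spaces.linear (*s) (*s) g" "\<forall>v\<in>range ((*v) F). F *v g v = v"
    using vec.linear_exists_right_inverse_on[OF lin vec.subspace_UNIV] by blast
  have "(F ** matrix g ** F) *v x = F *v x" for x
    using g by (simp add: matrix_vector_mul_assoc[symmetric] matrix_works)
  then show ?thesis using matrix_eq by blast
qed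

text \<open>Because \<open>F\<close> is equivariant, every conjugate
  \<open>X k ** R0 ** Y (matrix_inv k)\<close> is again a generalized inverse. Generalized inverses
  of \<open>F\<close> form an affine space, so the average is one too, and it is
  equivariant.\<close>

lemma exists_equivariant_generalized_inverse:
  fixes F :: "complex^'n^'k"
  assumes G: "compact_matrix_group G" and X: "representation G X" and Y: "representation G Y"
    and F: "\<And>g. g \<in> G \<Longrightarrow> F ** X g = Y g ** F"
  obtains R where "F ** R ** F = F" "\<And>g. g \<in> G \<Longrightarrow> R ** Y g = X g ** R"
proof -
  obtain R0 where R0: "F ** R0 ** F = F" using exists_generalized_inverse by blast
  note H = representation_hom[OF G Y X]
  obtain K c where K: "prob_weights G K c" "averaging G K c (hom_rep Y X)"
    using exists_averaging[OF G H H H] by blast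
  have KG: "K \<subseteq> G" using K by (simp add: prob_weights_def)
  define R where "R = average K c (\<lambda>k. X k ** R0 ** Y (matrix_inv k))"
  have "F ** R ** F = average K c (\<lambda>k. F ** (X k ** R0 ** Y (matrix_inv k)) ** F)"
    unfolding R_def average_linear[OF linear_matrix_mult_left] average_linear[OF linear_matrix_mult_right] ..
  also have "\<dots> = average K c (\<lambda>k. F)"
  proof (rule average_cong)
    fix k assume "k \<in> K"
    then have k: "k \<in> G" "matrix_inv k \<in> G" using KG compact_matrix_groupD(4)[OF G] by auto
    have "F ** (X k ** R0 ** Y (matrix_inv k)) ** F = (F ** X k) ** R0 ** (Y (matrix_inv k) ** F)"
      by (simp only: matrix_mul_assoc)
    also have "\<dots> = (Y k ** F) ** R0 ** (F ** X (matrix_inv k))" using F k by simp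
    also have "\<dots> = Y k ** (F ** R0 ** F) ** X (matrix_inv k)" by (simp only: matrix_mul_assoc)
    also have "\<dots> = F ** (X k ** X (matrix_inv k))" using F k R0 by (simp add: matrix_mul_assoc)
    also have "\<dots> = F" using representation_inv(1)[OF G X] k by simp
    finally show "F ** (X k ** R0 ** Y (matrix_inv k)) ** F = F" .
  qed
  finally have "F ** R ** F = F" using average_const[OF K(1)] by simp
  then show ?thesis
    by (rule that) (unfold R_def, rule averaging_intertwines[OF G Y K(2)])
qed

text \<open>An intertwiner \<open>F\<close> with minimal kernel has an equivariant generalized inverse \<open>R\<close>. Put
  \<open>P = 1 - R F\<close> and \<open>Q = 1 - F R\<close>. A nonzero intertwiner \<open>H = Q H P\<close> would make the kernel of
  \<open>F + H\<close> smaller. So there is none, and the vanishing of the corresponding average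
  forces \<open>P = 0\<close> and \<open>Q = 0\<close>.\<close>

lemma rep_iso_of_averaged_traces:
  fixes X :: "complex^'m^'m \<Rightarrow> complex^'n^'n" and Y :: "complex^'m^'m \<Rightarrow> complex^'k^'k"
  assumes G: "compact_matrix_group G" and X: "representation G X" and Y: "representation G Y"
    and K: "prob_weights G K c" and av: "averaging G K c (hom_rep X X)"
      "averaging G K c (hom_rep X Y)" "averaging G K c (hom_rep Y Y)"
    and tr: "\<And>k. k \<in> K \<Longrightarrow> c k \<noteq> 0 \<Longrightarrow> trace (X k) = trace (Y k)"
  shows "rep_iso G X Y"
proof -
  have KG: "K \<subseteq> G" using K by (simp add: prob_weights_def)
  define I where "I F \<longleftrightarrow> (\<forall>g\<in>G. F ** X g = Y g ** F)" for F :: "complex^'n^'k"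
  define ker where "ker F = {v. F *v v = 0}" for F :: "complex^'n^'k"
  have sub: "vec.subspace (ker F)" for F
    by (auto simp: ker_def vec.subspace_def matrix_vector_right_distrib vec.scale)
  have "I 0" by (simp add: I_def linear_0[OF linear_matrix_mult_left] linear_0[OF linear_matrix_mult_right])
  then obtain F where F: "I F" "\<And>F'. I F' \<Longrightarrow> vec.dim (ker F) \<le> vec.dim (ker F')"
    using ex_has_least_nat[of I 0 "\<lambda>F. vec.dim (ker F)"] by blast
  have FX: "F ** X g = Y g ** F" if "g \<in> G" for g using F(1) that by (simp add: I_def)
  obtain R where R: "F ** R ** F = F" and RY: "\<And>g. g \<in> G \<Longrightarrow> R ** Y g = X g ** R"
    using exists_equivariant_generalized_inverse[OF G X Y FX] by blast
  define P where "P = mat 1 - R ** F"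
  define Q where "Q = mat 1 - F ** R"
  have RFRF: "R ** F ** R ** F = R ** F" and FRFR: "F ** R ** F ** R = F ** R"
    using R by (simp_all add: matrix_mul_assoc[symmetric])
  have PP: "P ** P = P" and QQ: "Q ** Q = Q"
    by (simp_all add: P_def Q_def matrix_mult_diff_distrib matrix_mul_assoc RFRF FRFR)
  have FP: "F ** P = 0" by (simp add: P_def matrix_mult_diff_distrib matrix_mul_assoc R)
  have FRQ: "F ** R ** Q = 0" by (simp add: Q_def matrix_mult_diff_distrib matrix_mul_assoc FRFR)
  have PX: "P ** X g = X g ** P" if g: "g \<in> G" for g
  proof -
    have "R ** F ** X g = R ** Y g ** F" using FX[OF g] by (simp add: matrix_mul_assoc[symmetric])
    then have "R ** F ** X g = X g ** R ** F" using RY[OF g] by simp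
    then show ?thesis by (simp add: P_def matrix_mult_diff_distrib matrix_mul_assoc)
  qed
  have QY: "Q ** Y g = Y g ** Q" if g: "g \<in> G" for g
  proof -
    have "F ** R ** Y g = F ** X g ** R" using RY[OF g] by (simp add: matrix_mul_assoc[symmetric])
    then have "F ** R ** Y g = Y g ** F ** R" using FX[OF g] by simp
    then show ?thesis by (simp add: Q_def matrix_mult_diff_distrib matrix_mul_assoc)
  qed
  \<comment> \<open>\<open>R ** F\<close> and \<open>F ** R\<close> project onto the parts matched
    by \<open>F\<close>, whose traces agree by cyclicity. Equal full traces then leave equal traces
    on the complements.\<close>
  have trPQ: "trace (X k ** P) = trace (Y k ** Q)" if k: "k \<in> K" "c k \<noteq> 0" for k
  proof -
    have "F ** X k = Y k ** F" using FX k KG by blast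
    then have "trace (Y k ** (F ** R)) = trace (F ** (X k ** R))"
      by (simp add: matrix_mul_assoc)
    also have "\<dots> = trace (X k ** (R ** F))"
      by (subst trace_mul_sym) (simp only: matrix_mul_assoc)
    finally show ?thesis
      using tr[OF k] by (simp add: P_def Q_def matrix_mult_diff_distrib trace_sub)
  qed
  have maximal: "H = 0" if H: "I H" "Q ** H ** P = H" for H
  proof (rule ccontr)
    assume "H \<noteq> 0"
    then obtain v where v: "H *v v \<noteq> 0" using matrix_eq[of H 0] by auto
    have "I (F + H)"
      using F(1) H(1) by (simp add: I_def linear_add[OF linear_matrix_mult_left] linear_add[OF linear_matrix_mult_right])
    have FRH: "F ** R ** H = 0"
    proof -
      have "F ** R ** H = F ** R ** Q ** H ** P" using H(2) by (simp add: matrix_mul_assoc[symmetric])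
      then show ?thesis
        by (simp add: FRQ linear_0[OF linear_matrix_mult_right])
    qed
    have HP: "H ** P = H"
    proof -
      have "H ** P = Q ** H ** (P ** P)" using H(2) by (simp add: matrix_mul_assoc)
      then show ?thesis using PP H(2) by simp
    qed
    \<comment> \<open>Applying \<open>F ** R\<close> to \<open>F w + H w = 0\<close> leaves
      \<open>F w = 0\<close>, since \<open>F R F = F\<close> and \<open>F R H = 0\<close>.\<close>
    have "ker (F + H) \<subseteq> ker F"
    proof
      fix w assume "w \<in> ker (F + H)"
      then have w: "F *v w + H *v w = 0" by (simp add: ker_def matrix_vector_mult_add_rdistrib)
      have "F *v w = (F ** R ** F) *v w + (F ** R ** H) *v w" using R FRH by simp
      also have "\<dots> = (F ** R) *v (F *v w + H *v w)"
        by (simp add: matrix_vector_mul_assoc matrix_vector_right_distrib)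
      finally show "w \<in> ker F" using w by (simp add: ker_def)
    qed
    moreover have "P *v v \<in> ker F" using FP by (simp add: ker_def matrix_vector_mul_assoc)
    \<comment> \<open>The inclusion is strict: \<open>F\<close> kills \<open>P v\<close>, while
      \<open>H P v = H v\<close> is nonzero.\<close>
    moreover have "P *v v \<notin> ker (F + H)"
      using v FP HP by (simp add: ker_def matrix_vector_mult_add_rdistrib matrix_vector_mul_assoc)
    ultimately have "ker (F + H) \<subset> ker F" by blast
    then have "vec.dim (ker (F + H)) < vec.dim (ker F)"
      using vec.dim_psubset[of "ker (F + H)" "ker F"] by (simp add: vec.span_eq_iff[THEN iffD2, OF sub])
    with F(2)[OF \<open>I (F + H)\<close>] show False by simp
  qed
  \<comment> \<open>\<open>S\<close> projects onto the equivariant maps \<open>B\<close> with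
    \<open>Q B P = B\<close>. The previous step leaves only 0, so the trace of \<open>S\<close>
    vanishes.\<close>
  define S where "S = average K c (\<lambda>k. kron (transpose (P ** X (matrix_inv k))) (Y k ** Q))"
  have S0: "S *v vec_of A = 0" for A
  proof -
    define B where "B = average K c (\<lambda>k. Y k ** (Q ** A ** P) ** X (matrix_inv k))"
    have "I B" unfolding I_def B_def using averaging_intertwines[OF G X av(2)] by blast
    moreover have "Q ** B ** P = B"
      unfolding B_def average_linear[OF linear_matrix_mult_left] average_linear[OF linear_matrix_mult_right]
    proof (rule average_cong)
      fix k assume "k \<in> K"
      then have k: "k \<in> G" "matrix_inv k \<in> G" using KG compact_matrix_groupD(4)[OF G] by auto
      have "Q ** (Y k ** (Q ** A ** P) ** X (matrix_inv k)) ** P =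
          (Q ** Y k) ** (Q ** A ** P) ** (X (matrix_inv k) ** P)" by (simp only: matrix_mul_assoc)
      also have "\<dots> = (Y k ** Q) ** (Q ** A ** P) ** (P ** X (matrix_inv k))"
        using k PX QY by simp
      also have "\<dots> = Y k ** ((Q ** Q) ** A ** (P ** P)) ** X (matrix_inv k)"
        by (simp only: matrix_mul_assoc)
      finally show "Q ** (Y k ** (Q ** A ** P) ** X (matrix_inv k)) ** P =
          Y k ** (Q ** A ** P) ** X (matrix_inv k)" by (simp only: PP QQ)
    qed
    ultimately have "B = 0" by (rule maximal)
    moreover have "S *v vec_of A = vec_of B"
      unfolding S_def B_def average_linear[OF linear_matrix_vector] average_linear[OF linear_vec_of]
      by (simp add: kron_vec_of transpose_transpose matrix_mul_assoc)
    ultimately show ?thesis by (simp add: linear_0[OF linear_vec_of])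
  qed
  have "S *v v = 0" for v using S0[of "mat_of v"] by simp
  then have "S = 0" by (simp add: matrix_eq)
  then have "trace S = 0" by (simp add: linear_0[OF linear_trace])
  then have "average K c (\<lambda>k. trace (kron (transpose (P ** X (matrix_inv k))) (Y k ** Q))) = 0"
    unfolding S_def average_linear[OF linear_trace] .
  then have "average K c (\<lambda>k. trace (Y k ** Q) * trace (P ** X (matrix_inv k))) = 0"
    by (simp add: trace_kron trace_transpose mult.commute)
  moreover have "average K c (\<lambda>k. trace (Y k ** Q) * trace (P ** X (matrix_inv k))) =
      average K c (\<lambda>k. trace (X k ** P) * trace (P ** X (matrix_inv k)))"
    using trPQ by (intro average_cong_support) simp
  ultimately have "P = 0"
    by (intro equivariant_idempotent_eq_0[OF K av(1) G X PP PX]) auto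
  \<comment> \<open>With \<open>P = 0\<close>, the equality \<open>trPQ\<close> makes the trace of
    \<open>Y k ** Q\<close> vanish wherever the weight is nonzero, so the same argument applies to
    \<open>Q\<close>.\<close>
  then have "average K c (\<lambda>k. trace (Y k ** Q) * trace (Q ** Y (matrix_inv k))) = average K c (\<lambda>k. 0)"
    using trPQ by (intro average_cong_support) (auto simp: linear_0[OF linear_matrix_mult_left] linear_0[OF linear_trace])
  then have "Q = 0"
    by (intro equivariant_idempotent_eq_0[OF K av(3) G Y QQ QY]) (auto simp: average_def)
  with \<open>P = 0\<close> have "invertible F" by (auto simp: invertible_def P_def Q_def)
  with FX show ?thesis by (auto simp: rep_iso_def)
qed

section \<open>The inequality between dimensions of Hom spaces\<close>

lemma rep_iso_trace_eq:
  assumes "rep_iso G X Y" "g \<in> G"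
  shows "trace (X g) = trace (Y g)"
proof -
  obtain F where F: "invertible F" "F ** X g = Y g ** F" using assms by (auto simp: rep_iso_def)
  have "trace (X g) = trace (matrix_inv F ** (F ** X g))"
    using matrix_inv_mult(2)[OF F(1)] by (simp add: matrix_mul_assoc)
  also have "\<dots> = trace (Y g ** (F ** matrix_inv F))"
    unfolding F(2) by (subst trace_mul_sym) (simp only: matrix_mul_assoc)
  finally show ?thesis using matrix_inv_mult(1)[OF F(1)] by simp
qed

lemma hom_dim_inequality:
  fixes X :: "complex^'m^'m \<Rightarrow> complex^'n^'n" and Y :: "complex^'m^'m \<Rightarrow> complex^'k^'k"
  assumes G: "compact_matrix_group G" and X: "representation G X" and Y: "representation G Y"
  defines "dXX \<equiv> vec.dim (zero_weight_space G (hom_rep X X))"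
    and "dXY \<equiv> vec.dim (zero_weight_space G (hom_rep X Y))"
    and "dYY \<equiv> vec.dim (zero_weight_space G (hom_rep Y Y))"
  shows "2 * dXY \<le> dXX + dYY" "dXX + dYY = 2 * dXY \<longleftrightarrow> rep_iso G X Y"
proof -
  obtain K c where K: "prob_weights G K c" and av: "averaging G K c (hom_rep X X)"
      "averaging G K c (hom_rep X Y)" "averaging G K c (hom_rep Y Y)"
    using exists_averaging representation_hom G X Y by metis
  have KG: "K \<subseteq> G" and c: "finite K" "\<And>k. k \<in> K \<Longrightarrow> 0 \<le> c k" using K by (auto simp: prob_weights_def)
  \<comment> \<open>Dimensions are real, so real parts may be taken; \<open>2 * dXY\<close> then
    supplies the full cross term of the squared modulus with no recourse to Hom(Y,X).\<close>
  have dim: "real (vec.dim (zero_weight_space G (hom_rep U V))) =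
      (\<Sum>k\<in>K. c k * Re (cnj (trace (U k)) * trace (V k)))"
    if "averaging G K c (hom_rep U V)" "representation G U" for U :: "complex^'m^'m \<Rightarrow> complex^'i^'i"
      and V :: "complex^'m^'m \<Rightarrow> complex^'j^'j"
  proof -
    have "complex_of_real (real (vec.dim (zero_weight_space G (hom_rep U V)))) = 
       (\<Sum>k\<in>K. c k *\<^sub>R (cnj (trace (U k)) * trace (V k)))"
      using averaging_fixed_dim[OF K that(1)] KG trace_hom_rep[OF G that(2), of _ V]
      by (simp add: average_def subset_iff cong: sum.cong)
    from arg_cong[OF this, of Re] show ?thesis by simp
  qed
  have "real dXX + real dYY - 2 * real dXY = (\<Sum>k\<in>K. c k * Re (cnj (trace (X k)) * trace (X k)) +
      c k * Re (cnj (trace (Y k)) * trace (Y k)) - 2 * (c k * Re (cnj (trace (X k)) * trace (Y k))))"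
    unfolding dXX_def dXY_def dYY_def dim[OF av(1) X] dim[OF av(2) X] dim[OF av(3) Y]
    by (simp only: sum.distrib sum_subtractf sum_distrib_left)
  also have "\<dots> = (\<Sum>k\<in>K. c k * (cmod (trace (X k) - trace (Y k)))\<^sup>2)"
    unfolding cmod_power2 by (intro sum.cong) (auto simp: power2_eq_square algebra_simps)
  finally have *: "real dXX + real dYY - 2 * real dXY = (\<Sum>k\<in>K. c k * (cmod (trace (X k) - trace (Y k)))\<^sup>2)" .
  have "0 \<le> (\<Sum>k\<in>K. c k * (cmod (trace (X k) - trace (Y k)))\<^sup>2)"
    using c by (intro sum_nonneg) auto
  with * show "2 * dXY \<le> dXX + dYY" by linarith
  show "dXX + dYY = 2 * dXY \<longleftrightarrow> rep_iso G X Y"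
  proof
    assume "dXX + dYY = 2 * dXY"
    then have "(\<Sum>k\<in>K. c k * (cmod (trace (X k) - trace (Y k)))\<^sup>2) = 0" using * by linarith
    then have "\<forall>k\<in>K. c k * (cmod (trace (X k) - trace (Y k)))\<^sup>2 = 0"
      using c by (subst (asm) sum_nonneg_eq_0_iff) auto
    \<comment> \<open>The characters are known to agree only at the points of \<open>K\<close> with
      nonzero weight, which is what the averaged criterion asks for.\<close>
    then show "rep_iso G X Y"
      by (intro rep_iso_of_averaged_traces[OF G X Y K av]) auto
  next
    assume "rep_iso G X Y"
    then have "trace (X g) = trace (Y g)" if "g \<in> G" for g using rep_iso_trace_eq that by blast
    then have "(\<Sum>k\<in>K. c k * (cmod (trace (X k) - trace (Y k)))\<^sup>2) = 0"
      using KG by (intro sum.neutral) auto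
    then show "dXX + dYY = 2 * dXY" using * by linarith
  qed
qed

lemma rep_iso_of_trace_eq:
  fixes X :: "complex^'m^'m \<Rightarrow> complex^'n^'n" and Y :: "complex^'m^'m \<Rightarrow> complex^'k^'k"
  assumes G: "compact_matrix_group G" and X: "representation G X" and Y: "representation G Y"
    and tr: "\<And>g. g \<in> G \<Longrightarrow> trace (X g) = trace (Y g)"
  shows "rep_iso G X Y"
proof -
  obtain K c where K: "prob_weights G K c" "averaging G K c (hom_rep X X)"
      "averaging G K c (hom_rep X Y)" "averaging G K c (hom_rep Y Y)"
    using exists_averaging representation_hom G X Y by metis
  then have "K \<subseteq> G" by (simp add: prob_weights_def)
  then show ?thesis using tr by (intro rep_iso_of_averaged_traces[OF G X Y K]) auto
qed

section \<open>From Hom spaces to tensor products, and from a subgroup to the group\<close>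

lemma dim_direct_sum:
  fixes A :: "(complex^'n) set" and B :: "(complex^'k) set"
  assumes A: "vec.subspace A" and B: "vec.subspace B"
  shows "vec.dim (direct_sum A B) = vec.dim A + vec.dim B"
proof -
  define inl :: "complex^'n \<Rightarrow> complex^('n + 'k)"
    where "inl v = (\<chi> i. case i of Inl a \<Rightarrow> v $ a | Inr b \<Rightarrow> 0)" for v
  define inr :: "complex^'k \<Rightarrow> complex^('n + 'k)"
    where "inr v = (\<chi> i. case i of Inl a \<Rightarrow> 0 | Inr b \<Rightarrow> v $ b)" for v
  have lin: "Vector_Spaces.linear (*s) (*s) inl" "Vector_Spaces.linear (*s) (*s) inr"
    by (auto simp: Vector_Spaces.linear_iff inl_def inr_def vec_eq_iff vec.vector_space_axioms split: sum.split)
  have inl_inr: "inl v $ Inl a = v $ a" "inl v $ Inr b = 0" "inr w $ Inl a = 0" "inr w $ Inr b = w $ b" for v w a b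
    by (simp_all add: inl_def inr_def)
  have inj: "inj inl" "inj inr"
    by (auto intro!: injI simp: vec_eq_iff) (metis inl_inr)+
  have Int: "inl ` A \<inter> inr ` B \<subseteq> {0}"
  proof
    fix x assume "x \<in> inl ` A \<inter> inr ` B"
    then obtain v w where "x = inl v" "x = inr w" by blast
    then have "x $ i = 0" for i using inl_inr by (cases i) metis+
    then show "x \<in> {0}" by (simp add: vec_eq_iff)
  qed
  have "direct_sum A B = {x + y |x y. x \<in> inl ` A \<and> y \<in> inr ` B}"
  proof (intro equalityI subsetI)
    fix x assume "x \<in> direct_sum A B"
    moreover have "x = inl (\<chi> i. x $ Inl i) + inr (\<chi> j. x $ Inr j)"
      by (auto simp: vec_eq_iff inl_def inr_def split: sum.split)
    ultimately show "x \<in> {x + y |x y. x \<in> inl ` A \<and> y \<in> inr ` B}"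
      unfolding direct_sum_def by blast
  next
    fix x assume "x \<in> {x + y |x y. x \<in> inl ` A \<and> y \<in> inr ` B}"
    then show "x \<in> direct_sum A B" by (auto simp: direct_sum_def inl_inr)
  qed
  moreover have "vec.dim {x + y |x y. x \<in> inl ` A \<and> y \<in> inr ` B} + vec.dim (inl ` A \<inter> inr ` B) =
      vec.dim (inl ` A) + vec.dim (inr ` B)"
    using A B lin by (intro vec.dim_sums_Int vec.linear_subspace_image)
  moreover have "vec.dim (inl ` A \<inter> inr ` B) = 0" using Int by (simp add: vec.dim_eq_0)
  moreover have "vec.dim (inl ` A) = vec.dim A" "vec.dim (inr ` B) = vec.dim B"
    using lin inj by (auto intro!: vec.dim_image_eq intro: inj_on_subset)
  ultimately show ?thesis by simp
qed

lemma subspace_zero_weight_space: "vec.subspace (zero_weight_space G \<rho>)"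
  by (auto simp: zero_weight_space_def vec.subspace_def matrix_vector_right_distrib vec.scale)

lemma representation_subset: "representation G \<rho> \<Longrightarrow> T \<subseteq> G \<Longrightarrow> representation T \<rho>"
  unfolding representation_def by (blast intro: continuous_on_subset)

text \<open>A real character equals that of the dual, so \<open>tensor_rep\<close> and
  \<open>hom_rep\<close> have the same character and equally many invariants.\<close>

lemma tensor_dim_inequality:
  fixes X :: "complex^'m^'m \<Rightarrow> complex^'n^'n" and Y :: "complex^'m^'m \<Rightarrow> complex^'k^'k"
  assumes G: "compact_matrix_group G" and X: "representation G X" and Y: "representation G Y"
    and real: "\<And>g. g \<in> G \<Longrightarrow> cnj (trace (X g)) = trace (X g)" "\<And>g. g \<in> G \<Longrightarrow> cnj (trace (Y g)) = trace (Y g)"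
  defines "d \<equiv> vec.dim (direct_sum (zero_weight_space G (tensor_rep X X)) (zero_weight_space G (tensor_rep Y Y)))"
  shows "2 * vec.dim (zero_weight_space G (tensor_rep X Y)) \<le> d"
    "d = 2 * vec.dim (zero_weight_space G (tensor_rep X Y)) \<longleftrightarrow> rep_iso G X Y"
proof -
  have eq: "vec.dim (zero_weight_space G (tensor_rep U V)) = vec.dim (zero_weight_space G (hom_rep U V))"
    if "representation G U" "representation G V" "\<And>g. g \<in> G \<Longrightarrow> cnj (trace (U g)) = trace (U g)"
    for U :: "complex^'m^'m \<Rightarrow> complex^'i^'i" and V :: "complex^'m^'m \<Rightarrow> complex^'j^'j"
    by (rule fixed_dim_cong_trace[OF G representation_tensor[OF that(1,2)] representation_hom[OF G that(1,2)]])
      (simp add: trace_tensor_rep trace_dual_rep[OF G that(1)] that(3))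
  show "2 * vec.dim (zero_weight_space G (tensor_rep X Y)) \<le> d"
    "d = 2 * vec.dim (zero_weight_space G (tensor_rep X Y)) \<longleftrightarrow> rep_iso G X Y"
    using hom_dim_inequality[OF G X Y] eq[OF X X] eq[OF X Y] eq[OF Y Y] real
    by (simp_all add: d_def dim_direct_sum subspace_zero_weight_space)
qed

lemma self_dual_trace_real:
  assumes "compact_matrix_group G" "representation G X" "self_dual G X" "g \<in> G"
  shows "cnj (trace (X g)) = trace (X g)"
  using rep_iso_trace_eq[of G X "dual_rep X" g] trace_dual_rep[of G X g] assms
  by (simp add: self_dual_def)

lemma trace_conjugate:
  assumes G: "compact_matrix_group G" and X: "representation G X" and "h \<in> G" "t \<in> G"
  shows "trace (X (h ** t ** matrix_inv h)) = trace (X t)"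
proof -
  have "X (h ** t ** matrix_inv h) = X h ** (X t ** X (matrix_inv h))"
    using assms compact_matrix_groupD[OF G] representationD(3)[OF X] by (simp add: matrix_mul_assoc)
  then have "trace (X (h ** t ** matrix_inv h)) = trace (X t ** X (matrix_inv h) ** X h)"
    using trace_mul_sym by metis
  then show ?thesis
    using representation_inv(2)[OF G X \<open>h \<in> G\<close>] by (simp add: matrix_mul_assoc[symmetric])
qed

text \<open>Characters are class functions: agreement on \<open>T\<close> spreads to all conjugates
  of \<open>T\<close>, that is, to \<open>G\<close>, where the character determines the
  representation.\<close>

lemma rep_iso_subgroup_iff:
  fixes X :: "complex^'m^'m \<Rightarrow> complex^'n^'n" and Y :: "complex^'m^'m \<Rightarrow> complex^'k^'k"
  assumes G: "compact_matrix_group G" and X: "representation G X" and Y: "representation G Y" and T: "T \<subseteq> G"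
    and conj: "\<And>g. g \<in> G \<Longrightarrow> \<exists>h\<in>G. \<exists>t\<in>T. g = h ** t ** matrix_inv h"
  shows "rep_iso T X Y \<longleftrightarrow> rep_iso G X Y"
proof
  assume iso: "rep_iso T X Y"
  show "rep_iso G X Y"
  proof (rule rep_iso_of_trace_eq[OF G X Y])
    fix g assume "g \<in> G"
    then obtain h t where ht: "h \<in> G" "t \<in> T" "g = h ** t ** matrix_inv h" using conj by blast
    then have "t \<in> G" using T by blast
    then show "trace (X g) = trace (Y g)"
      using ht rep_iso_trace_eq[OF iso \<open>t \<in> T\<close>] trace_conjugate[OF G X] trace_conjugate[OF G Y] by simp
  qed
next
  assume "rep_iso G X Y"
  then show "rep_iso T X Y" using T by (auto simp: rep_iso_def)
qed

section \<open>The group \<open>SU2\<close> and its torus\<close>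

lemma matrix_inv_eqI:
  fixes A B :: "'a::field^'n^'n"
  assumes "A ** B = mat 1"
  shows "matrix_inv A = B"
proof -
  have *: "B ** A = mat 1" using assms matrix_left_right_inverse by blast
  then have "invertible A" using assms by (auto simp: invertible_def)
  then have "matrix_inv A ** (A ** B) = B" by (simp add: matrix_mul_assoc matrix_inv_mult)
  then show ?thesis by (simp add: assms)
qed

lemmas matrix_2_simps = vec_eq_iff forall_2 sum_2 matrix_matrix_mult_def mat_def ctranspose_def det_2
  SU2_torus_def

lemma SU2_mult: "A \<in> SU2 \<Longrightarrow> B \<in> SU2 \<Longrightarrow> A ** B \<in> SU2"
proof -
  assume A: "A \<in> SU2" and B: "B \<in> SU2"
  have "ctranspose (A ** B) ** (A ** B) = ctranspose B ** (ctranspose A ** A) ** B"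
    by (simp only: ctranspose_mult matrix_mul_assoc)
  then show "A ** B \<in> SU2" using A B by (simp add: SU2_def det_mul)
qed

lemma SU2_inv:
  assumes "A \<in> SU2"
  shows "A ** ctranspose A = mat 1" "matrix_inv A = ctranspose A" "ctranspose A \<in> SU2"
proof -
  have A: "ctranspose A ** A = mat 1" "det A = 1" using assms by (auto simp: SU2_def)
  show *: "A ** ctranspose A = mat 1" using A(1) matrix_left_right_inverse by blast
  show "matrix_inv A = ctranspose A" by (rule matrix_inv_eqI[OF *])
  have "ctranspose (ctranspose A) = A" by (simp add: ctranspose_def vec_eq_iff)
  moreover have "det (ctranspose A) * det A = 1" unfolding det_mul[symmetric] by (simp add: A(1))
  ultimately show "ctranspose A \<in> SU2" using * A(2) by (simp add: SU2_def)
qed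

lemma compact_matrix_group_SU2: "compact_matrix_group SU2"
proof -
  have ct: "continuous_on UNIV (ctranspose :: complex^2^2 \<Rightarrow> _)"
    unfolding ctranspose_def by (intro continuous_intros)
  have "closed {A :: complex^2^2. ctranspose A ** A = mat 1}"
    by (intro closed_Collect_eq continuous_on_matrix_mult ct continuous_on_id continuous_on_const)
  moreover have "closed {A :: complex^2^2. det A = 1}"
    unfolding det_2 by (intro closed_Collect_eq continuous_intros)
  ultimately have "closed SU2"
    unfolding SU2_def by (rule closed_Collect_conj)
  \<comment> \<open>The columns are unit vectors, so entries have modulus at most 1; 4 is the crude
    sum over the four entries.\<close>
  moreover have "norm A \<le> 4" if "A \<in> SU2" for A
  proof -
    have "(ctranspose A ** A) $ j $ j = 1" for j using that by (simp add: SU2_def mat_def)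
    then have "(\<Sum>i\<in>UNIV. cnj (A $ i $ j) * A $ i $ j) = 1" for j
      by (simp add: ctranspose_def matrix_matrix_mult_def)
    then have "complex_of_real (\<Sum>i\<in>UNIV. (cmod (A $ i $ j))\<^sup>2) = 1" for j
      by (simp add: complex_norm_square mult.commute del: of_real_power)
    then have sum1: "(\<Sum>i\<in>UNIV. (cmod (A $ i $ j))\<^sup>2) = 1" for j
      using of_real_eq_1_iff by blast
    have "(cmod (A $ i $ j))\<^sup>2 \<le> 1" for i j
      unfolding sum1[of j, symmetric] by (rule member_le_sum) auto
    then have entry: "cmod (A $ i $ j) \<le> 1" for i j
      using abs_le_square_iff[of "cmod (A $ i $ j)" 1] by simp
    have row: "norm (A $ i) \<le> 2" for i
    proof -
      have "norm (A $ i) \<le> (\<Sum>j\<in>UNIV. cmod (A $ i $ j))"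
        unfolding norm_vec_def by (rule L2_set_le_sum) auto
      also have "\<dots> \<le> 2" using entry[of i 1] entry[of i 2] by (simp add: sum_2)
      finally show ?thesis .
    qed
    have "norm A \<le> (\<Sum>i\<in>UNIV. norm (A $ i))"
      unfolding norm_vec_def[of A] by (rule L2_set_le_sum) auto
    also have "\<dots> \<le> 4" using row[of 1] row[of 2] by (simp add: sum_2)
    finally show ?thesis .
  qed
  then have "bounded SU2" by (auto simp: bounded_iff)
  ultimately have "compact SU2" by (simp add: compact_eq_bounded_closed)
  moreover have "mat 1 \<in> SU2" by (simp add: SU2_def matrix_2_simps)
  moreover have "invertible A \<and> matrix_inv A \<in> SU2" if "A \<in> SU2" for A
    using SU2_inv[OF that] that by (auto simp: invertible_def SU2_def)
  ultimately show ?thesis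
    by (auto simp: compact_matrix_group_def SU2_mult)
qed

section \<open>The diagonal torus, and conjugation into it\<close>

abbreviation torus_SU2 :: "(complex^2^2) set" where
  "torus_SU2 \<equiv> SU2_torus ` sphere 0 1"

lemma SU2_torus_mult: "SU2_torus z ** SU2_torus w = SU2_torus (z * w)"
  by (simp add: matrix_2_simps)

lemma SU2_torus_one: "SU2_torus 1 = mat 1"
  by (simp add: matrix_2_simps)

lemma matrix_inv_SU2_torus: "z \<noteq> 0 \<Longrightarrow> matrix_inv (SU2_torus z) = SU2_torus (inverse z)"
  by (intro matrix_inv_eqI) (simp add: SU2_torus_mult SU2_torus_one)

lemma SU2_torus_component: "SU2_torus z $ 1 $ 1 = z"
  by (simp add: SU2_torus_def)

lemma cnj_unit: "norm z = 1 \<Longrightarrow> cnj z = inverse z"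
  by (metis complex_norm_square inverse_unique of_real_1 power_one)

lemma torus_SU2_subset: "torus_SU2 \<subseteq> SU2"
proof
  fix A assume "A \<in> torus_SU2"
  then obtain z where z: "A = SU2_torus z" "norm z = 1" by auto
  then have "z \<noteq> 0" by auto
  then show "A \<in> SU2" by (simp add: z SU2_def matrix_2_simps cnj_unit)
qed

lemma continuous_on_SU2_torus: "continuous_on (- {0}) SU2_torus"
proof -
  have eq: "SU2_torus = (\<lambda>z. \<chi> i j. if i = 1 then (if j = 1 then z else 0) else (if j = 1 then 0 else inverse z))"
    by (simp add: fun_eq_iff matrix_2_simps)
  have "continuous_on (- {0 :: complex}) (\<lambda>z. if i = 1 then (if j = 1 then z else 0) else (if j = 1 then 0 else inverse z))"
    for i j :: 2
    by (cases "i = 1"; cases "j = 1") (auto intro!: continuous_intros)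
  then show ?thesis unfolding eq by (intro continuous_on_vec_lambda)
qed

lemma compact_matrix_group_torus_SU2: "compact_matrix_group torus_SU2"
proof -
  have "compact torus_SU2"
    by (intro compact_continuous_image continuous_on_subset[OF continuous_on_SU2_torus]) auto
  moreover have "mat 1 \<in> torus_SU2" by (rule image_eqI[where x = 1]) (auto simp: SU2_torus_one)
  moreover have "A ** B \<in> torus_SU2" if "A \<in> torus_SU2" "B \<in> torus_SU2" for A B
    using that by (auto simp: SU2_torus_mult norm_mult intro!: imageI)
  moreover have "invertible A \<and> matrix_inv A \<in> torus_SU2" if A: "A \<in> torus_SU2" for A
  proof
    show "invertible A"
      using A torus_SU2_subset compact_matrix_group_SU2 by (auto simp: compact_matrix_group_def)
    obtain z where z: "A = SU2_torus z" "norm z = 1" using A by auto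
    then have "z \<noteq> 0" by auto
    then show "matrix_inv A \<in> torus_SU2"
      using z by (auto simp: matrix_inv_SU2_torus norm_inverse intro!: imageI)
  qed
  ultimately show ?thesis by (auto simp: compact_matrix_group_def)
qed

text \<open>Diagonalisation by hand: a unit eigenvector is completed to a basis by an element of
  \<open>SU2\<close>, and a triangular unitary matrix is diagonal.\<close>

lemma SU2_conjugate_torus:
  assumes g: "g \<in> SU2"
  shows "\<exists>h\<in>SU2. \<exists>t\<in>torus_SU2. g = h ** t ** matrix_inv h"
proof -
  define \<tau> where "\<tau> = trace g"
  \<comment> \<open>A root of the characteristic polynomial, which is
    \<open>z^2 - \<tau> z + 1\<close> as the determinant is 1.\<close>
  define z where "z = (\<tau> + csqrt (\<tau>\<^sup>2 - 4)) / 2"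
  have "z\<^sup>2 - \<tau> * z + 1 = 0"
  proof -
    have "2 * z - \<tau> = csqrt (\<tau>\<^sup>2 - 4)" by (simp add: z_def field_simps)
    then have "(2 * z - \<tau>)\<^sup>2 = \<tau>\<^sup>2 - 4" by simp
    then have "4 * (z\<^sup>2 - \<tau> * z + 1) = 0" by (simp add: power2_eq_square algebra_simps)
    then show ?thesis unfolding mult_eq_0_iff by simp
  qed
  moreover have "det g = 1" using g by (simp add: SU2_def)
  ultimately have "det (g - mat z) = 0"
    by (simp add: det_2 \<tau>_def trace_def sum_2 mat_def power2_eq_square algebra_simps)
  then have "\<not> invertible (g - mat z)" by (simp add: invertible_det_nz)
  then obtain v where v: "v \<noteq> 0" "(g - mat z) *v v = 0"
    using matrix_left_invertible_ker invertible_left_inverse by blast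
  define u where "u = inverse (norm v) *\<^sub>R v"
  have nu: "norm u = 1" using v(1) by (simp add: u_def)
  have "(g - mat z) *v u = inverse (norm v) *\<^sub>R ((g - mat z) *v v)"
    by (simp add: u_def vec_eq_iff matrix_vector_mult_def scaleR_sum_right)
  then have "(g - mat z) *v u = 0" using v(2) by simp
  then have gu: "g $ i $ 1 * u $ 1 + g $ i $ 2 * u $ 2 = z * u $ i" for i
    using exhaust_2[of i]
    by (auto simp: vec_eq_iff forall_2 matrix_vector_mult_def sum_2 mat_def algebra_simps)
  have "complex_of_real ((cmod (u $ 1))\<^sup>2 + (cmod (u $ 2))\<^sup>2) = 1"
    using nu by (simp add: norm_vec_def L2_set_def sum_2)
  then have uu: "cnj (u $ 1) * u $ 1 + cnj (u $ 2) * u $ 2 = 1"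
    by (simp add: complex_norm_square mult.commute del: of_real_power)
  \<comment> \<open>The first column is \<open>u\<close>; the second is the orthogonal unit vector
    that makes the determinant 1.\<close>
  define h :: "complex^2^2" where "h = vector [vector [u $ 1, - cnj (u $ 2)], vector [u $ 2, cnj (u $ 1)]]"
  have h: "h \<in> SU2"
    using uu by (simp add: SU2_def h_def matrix_2_simps algebra_simps)
  define D where "D = ctranspose h ** g ** h"
  have D: "D \<in> SU2" unfolding D_def by (intro SU2_mult SU2_inv(3)[OF h] g h)
  have D1: "D $ 1 $ 1 = z" "D $ 2 $ 1 = 0"
  proof -
    have "D $ i $ 1 = cnj (h $ 1 $ i) * (z * u $ 1) + cnj (h $ 2 $ i) * (z * u $ 2)" for i
      unfolding gu[symmetric] D_def matrix_mul_assoc[symmetric]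
      by (simp add: matrix_matrix_mult_def sum_2 ctranspose_def h_def)
    from this[of 1] this[of 2] show "D $ 1 $ 1 = z" "D $ 2 $ 1 = 0"
      using arg_cong[OF uu, of "\<lambda>x. z * x"] by (simp_all add: h_def algebra_simps)
  qed
  \<comment> \<open>Unitarity applied to the first column \<open>(z, 0)\<close> gives
    \<open>|z| = 1\<close> and kills the upper right entry; the determinant fixes the last
    entry.\<close>
  have "ctranspose D ** D = mat 1" "det D = 1" using D by (auto simp: SU2_def)
  then have *: "cnj z * z = 1" "cnj z * D $ 1 $ 2 = 0" "z * D $ 2 $ 2 = 1"
    using D1 by (auto simp: matrix_2_simps)
  have "z \<noteq> 0" using *(1) by auto
  then have "D = SU2_torus z"
    using * D1 by (simp add: matrix_2_simps field_simps)
  moreover have "norm z = 1"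
  proof -
    have "complex_of_real ((norm z)\<^sup>2) = 1" using *(1) by (simp add: complex_norm_square mult.commute del: of_real_power)
    then have "(norm z)\<^sup>2 = 1" using of_real_eq_1_iff by blast
    then show ?thesis by (simp add: abs_square_eq_1)
  qed
  moreover have "g = h ** D ** matrix_inv h"
  proof -
    have "h ** D ** matrix_inv h = (h ** ctranspose h) ** g ** (h ** ctranspose h)"
      by (simp add: D_def SU2_inv(2)[OF h] matrix_mul_assoc)
    then show ?thesis by (simp add: SU2_inv(1)[OF h])
  qed
  ultimately show ?thesis using h by (intro bexI[of _ h] bexI[of _ D]) auto
qed

text \<open>The Weyl element \<open>w\<close> conjugates \<open>t\<close> to its inverse, at which
  the character takes the conjugate value.\<close>

lemma SU2_torus_trace_real:
  assumes V: "representation SU2 V" and t: "t \<in> torus_SU2"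
  shows "cnj (trace (V t)) = trace (V t)"
proof -
  obtain z where z: "t = SU2_torus z" "norm z = 1" using t by auto
  then have z0: "z \<noteq> 0" by auto
  have tS: "t \<in> SU2" using t torus_SU2_subset by blast
  define w :: "complex^2^2" where "w = vector [vector [0, 1], vector [- 1, 0]]"
  have w: "w \<in> SU2" by (simp add: SU2_def w_def matrix_2_simps)
  have "w ** t ** ctranspose w = SU2_torus (inverse z)"
    by (simp add: z w_def matrix_2_simps)
  then have "w ** t ** matrix_inv w = matrix_inv t"
    using z0 by (simp add: SU2_inv(2)[OF w] z matrix_inv_SU2_torus)
  then show ?thesis
    using trace_conjugate[OF compact_matrix_group_SU2 V w tS]
      trace_representation_inv[OF compact_matrix_group_SU2 V tS] by simp
qed

section \<open>Weight spaces as torus invariants, and the case of opposite central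
  characters\<close>

lemma weight_space_0: "weight_space 0 \<rho> = zero_weight_space torus_SU2 \<rho>"
  by (auto simp: weight_space_def zero_weight_space_def)

definition scale_rep ::
    "(complex^'m^'m \<Rightarrow> complex) \<Rightarrow> (complex^'m^'m \<Rightarrow> complex^'n^'n) \<Rightarrow> complex^'m^'m \<Rightarrow> complex^'n^'n" where
  "scale_rep c \<rho> g = (\<chi> i j. c g * \<rho> g $ i $ j)"

lemma representation_scale:
  assumes "representation G \<rho>" "continuous_on G c" "c (mat 1) = 1"
    and "\<And>g h. g \<in> G \<Longrightarrow> h \<in> G \<Longrightarrow> c (g ** h) = c g * c h"
  shows "representation G (scale_rep c \<rho>)"
proof -
  have "continuous_on G (scale_rep c \<rho>)"
    unfolding scale_rep_def by (intro continuous_intros assms(2) representationD(1)[OF assms(1)])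
  then show ?thesis
    using assms(3,4) representationD(2,3)[OF assms(1)]
    by (simp add: representation_def scale_rep_def vec_eq_iff matrix_matrix_mult_def sum_distrib_left mult_ac)
qed

lemma trace_scale_rep: "trace (scale_rep c \<rho> g) = c g * trace (\<rho> g)"
  by (simp add: trace_def scale_rep_def sum_distrib_left)

text \<open>Twisting by the inverse of the standard character shifts weight 1 to weight 0; the upper
  left entry of a torus element recovers \<open>z\<close>.\<close>

lemma weight_space_1:
  "weight_space 1 \<rho> = zero_weight_space torus_SU2 (scale_rep (\<lambda>g. inverse (g $ 1 $ 1)) \<rho>)"
proof -
  have "\<rho> (SU2_torus z) *v v = z *s v \<longleftrightarrow>
      scale_rep (\<lambda>g. inverse (g $ 1 $ 1)) \<rho> (SU2_torus z) *v v = v" if "norm z = 1" for z v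
  proof -
    have "z \<noteq> 0" using that by auto
    have "scale_rep (\<lambda>g. inverse (g $ 1 $ 1)) \<rho> (SU2_torus z) *v v = inverse z *s (\<rho> (SU2_torus z) *v v)"
      by (simp add: scale_rep_def SU2_torus_component vec_eq_iff matrix_vector_mult_def sum_distrib_left mult_ac)
    then show ?thesis using \<open>z \<noteq> 0\<close> by (auto simp: vec_eq_iff field_simps)
  qed
  then show ?thesis by (auto simp: weight_space_def zero_weight_space_def)
qed

text \<open>The inequality is the Hom inequality on the torus for \<open>V\<close> and the twist
  \<open>Y\<close> of \<open>W\<close> by \<open>z\<close>. Strictness holds because
  \<open>Y\<close> and \<open>V\<close> cannot be isomorphic there: only one of the two characters
  would be real.\<close>

lemma weight_1_dim_inequality:
  fixes V :: "complex^2^2 \<Rightarrow> complex^'v^'v" and W :: "complex^2^2 \<Rightarrow> complex^'w^'w"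
  assumes V: "representation SU2 V" and W: "representation SU2 W"
  shows "2 * vec.dim (weight_space 1 (tensor_rep V W)) <
    vec.dim (direct_sum (weight_space 0 (tensor_rep V V)) (weight_space 0 (tensor_rep W W)))"
proof -
  note T = compact_matrix_group_torus_SU2
  have VT: "representation torus_SU2 V" and WT: "representation torus_SU2 W"
    using V W representation_subset torus_SU2_subset by blast+
  note real = SU2_torus_trace_real[OF V] SU2_torus_trace_real[OF W]
  let ?\<zeta> = "\<lambda>g :: complex^2^2. g $ 1 $ 1"
  have cont: "continuous_on torus_SU2 ?\<zeta>" by (intro continuous_intros)
  have \<zeta>0: "?\<zeta> g \<noteq> 0" and cnj\<zeta>: "cnj (?\<zeta> g) = inverse (?\<zeta> g)" if "g \<in> torus_SU2" for g
    using that cnj_unit by (auto simp: SU2_torus_component)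
  have \<zeta>mult: "?\<zeta> (g ** h) = ?\<zeta> g * ?\<zeta> h" if "g \<in> torus_SU2" "h \<in> torus_SU2" for g h
    using that by (auto simp: SU2_torus_component SU2_torus_mult)
  define Y where "Y = scale_rep ?\<zeta> W"
  have Y: "representation torus_SU2 Y"
    unfolding Y_def using WT cont \<zeta>mult by (intro representation_scale) (auto simp: mat_def)
  have trY: "trace (Y g) = ?\<zeta> g * trace (W g)" for g by (simp add: Y_def trace_scale_rep)
  have "representation torus_SU2 (scale_rep (\<lambda>g. inverse (?\<zeta> g)) (tensor_rep V W))"
    using representation_tensor[OF VT WT] cont \<zeta>mult \<zeta>0
    by (intro representation_scale continuous_on_inverse) (auto simp: mat_def)
  \<comment> \<open>Since the character of \<open>W\<close> is real,
    \<open>cnj (z * tr W) * tr V\<close> equals \<open>inverse z * tr V * tr W\<close>, the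
    character of the shifted tensor product.\<close>
  then have d1: "vec.dim (weight_space 1 (tensor_rep V W)) = vec.dim (zero_weight_space torus_SU2 (hom_rep Y V))"
    unfolding weight_space_1
    by (rule fixed_dim_cong_trace[OF T _ representation_hom[OF T Y VT]])
      (simp add: trace_tensor_rep trace_dual_rep[OF T Y] trY trace_scale_rep real cnj\<zeta>)
  have dV: "vec.dim (weight_space 0 (tensor_rep V V)) = vec.dim (zero_weight_space torus_SU2 (hom_rep V V))"
    unfolding weight_space_0
    by (rule fixed_dim_cong_trace[OF T representation_tensor[OF VT VT] representation_hom[OF T VT VT]])
      (simp add: trace_tensor_rep trace_dual_rep[OF T VT] real)
  \<comment> \<open>In Hom(Y,Y) the twist cancels: \<open>cnj z * z = 1\<close>.\<close>
  have dW: "vec.dim (weight_space 0 (tensor_rep W W)) = vec.dim (zero_weight_space torus_SU2 (hom_rep Y Y))"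
    unfolding weight_space_0
    by (rule fixed_dim_cong_trace[OF T representation_tensor[OF WT WT] representation_hom[OF T Y Y]])
      (simp add: trace_tensor_rep trace_dual_rep[OF T Y] trY real cnj\<zeta> \<zeta>0)
  have d: "vec.dim (direct_sum (weight_space 0 (tensor_rep V V)) (weight_space 0 (tensor_rep W W))) =
      vec.dim (zero_weight_space torus_SU2 (hom_rep Y Y)) + vec.dim (zero_weight_space torus_SU2 (hom_rep V V))"
    using dV dW by (simp add: dim_direct_sum weight_space_0 subspace_zero_weight_space)
  have "\<not> rep_iso torus_SU2 Y V"
  proof
    assume iso: "rep_iso torus_SU2 Y V"
    define f where "f \<theta> = trace (W (SU2_torus (cis \<theta>)))" for \<theta>
    have "f \<theta> = 0" if \<theta>: "\<theta> \<in> {0<..<pi}" for \<theta>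
    proof -
      let ?t = "SU2_torus (cis \<theta>)"
      have t: "?t \<in> torus_SU2" by simp
      have "cis \<theta> * f \<theta> = trace (V ?t)"
        using rep_iso_trace_eq[OF iso t] by (simp add: trY SU2_torus_component f_def)
      \<comment> \<open>Both \<open>f \<theta>\<close> and \<open>cis \<theta> * f \<theta>\<close>
        are real, so \<open>sin \<theta> * Re (f \<theta>)\<close> is 0, and the sine is positive on
        the open interval.\<close>
      then have "Im (cis \<theta> * f \<theta>) = 0" using real(1)[OF t] by (simp add: complex_cnj_cancel_iff complex_eq_iff)
      moreover have "Im (f \<theta>) = 0" using real(2)[OF t] by (simp add: f_def complex_eq_iff)
      ultimately have "sin \<theta> * Re (f \<theta>) = 0" by simp
      then show ?thesis
        using \<theta> sin_gt_zero[of \<theta>] \<open>Im (f \<theta>) = 0\<close> by (auto simp: complex_eq_iff)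
    qed
    moreover have "continuous_on UNIV f"
    proof -
      have "continuous_on UNIV (\<lambda>\<theta>. SU2_torus (cis \<theta>))"
        by (rule continuous_on_compose2[OF continuous_on_SU2_torus]) (auto intro!: continuous_intros)
      then have "continuous_on UNIV (\<lambda>\<theta>. W (SU2_torus (cis \<theta>)))"
        by (rule continuous_on_compose2[OF representationD(1)[OF WT]]) auto
      then show ?thesis
        unfolding f_def trace_def by (intro continuous_intros)
    qed
    then have "closed {\<theta>. f \<theta> = 0}" by (intro closed_Collect_eq continuous_intros)
    \<comment> \<open>Continuity carries the vanishing to the endpoint 0, where \<open>f\<close> is
      the dimension of \<open>W\<close>, which is positive because index types are nonempty.\<close>
    ultimately have "closure {0<..<pi} \<subseteq> {\<theta>. f \<theta> = 0}" by (intro closure_minimal) auto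
    from subsetD[OF this, of 0] have "f 0 = 0" using pi_gt_zero by (simp add: closure_greaterThanLessThan)
    moreover have "f 0 = of_nat CARD('w)"
      using representationD(2)[OF W] by (simp add: f_def SU2_torus_one trace_I)
    ultimately show False by simp
  qed
  then show ?thesis
    using hom_dim_inequality[OF T Y VT] by (simp add: d d1 less_le)
qed

text \<open>In the clause on compact groups the torus sees only restrictions to \<open>T\<close>, so
  equality is compared with isomorphism over \<open>T\<close>, and with isomorphism over
  \<open>G\<close> when the conjugates of \<open>T\<close> cover \<open>G\<close>. Self-duality
  provides there the real characters that the Weyl element provides for \<open>SU2\<close>.\<close>

theorem lemma1:
  fixes V :: "complex^2^2 \<Rightarrow> complex^'v^'v" and W :: "complex^2^2 \<Rightarrow> complex^'w^'w"
    and \<omega>\<^sub>V \<omega>\<^sub>W :: "complex^2^2 \<Rightarrow> complex"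
    and G T :: "(complex^'m^'m) set"
    and X :: "complex^'m^'m \<Rightarrow> complex^'x^'x" and Y :: "complex^'m^'m \<Rightarrow> complex^'y^'y"
    and \<omega> :: "complex^'m^'m \<Rightarrow> complex"
  assumes "representation SU2 V" and "representation SU2 W"
    and "has_central_character SU2 V \<omega>\<^sub>V" and "has_central_character SU2 W \<omega>\<^sub>W"
  shows
    "((\<forall>z\<in>group_center SU2. \<omega>\<^sub>V z = \<omega>\<^sub>W z) \<longrightarrow>
        vec.dim (direct_sum (weight_space 0 (tensor_rep V V)) (weight_space 0 (tensor_rep W W)))
          \<ge> 2 * vec.dim (weight_space 0 (tensor_rep V W)) \<and>
        (vec.dim (direct_sum (weight_space 0 (tensor_rep V V)) (weight_space 0 (tensor_rep W W)))
          = 2 * vec.dim (weight_space 0 (tensor_rep V W)) \<longleftrightarrow> rep_iso SU2 V W)) \<and>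
     (compact_matrix_group G \<and> maximal_torus G T \<and>
      representation G X \<and> representation G Y \<and> self_dual G X \<and> self_dual G Y \<and>
      has_central_character G X \<omega> \<and> has_central_character G Y \<omega> \<longrightarrow>
        vec.dim (direct_sum (zero_weight_space T (tensor_rep X X))
                            (zero_weight_space T (tensor_rep Y Y)))
          \<ge> 2 * vec.dim (zero_weight_space T (tensor_rep X Y)) \<and>
        (vec.dim (direct_sum (zero_weight_space T (tensor_rep X X))
                             (zero_weight_space T (tensor_rep Y Y)))
          = 2 * vec.dim (zero_weight_space T (tensor_rep X Y)) \<longleftrightarrow> rep_iso T X Y) \<and>
        ((\<forall>g\<in>G. \<exists>h\<in>G. \<exists>t\<in>T. g = h ** t ** matrix_inv h) \<longrightarrow>
          (vec.dim (direct_sum (zero_weight_space T (tensor_rep X X))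
                               (zero_weight_space T (tensor_rep Y Y)))
            = 2 * vec.dim (zero_weight_space T (tensor_rep X Y)) \<longleftrightarrow> rep_iso G X Y))) \<and>
     (\<omega>\<^sub>V (- mat 1) = 1 \<and> \<omega>\<^sub>W (- mat 1) = - 1 \<or> \<omega>\<^sub>V (- mat 1) = - 1 \<and> \<omega>\<^sub>W (- mat 1) = 1 \<longrightarrow>
        vec.dim (direct_sum (weight_space 0 (tensor_rep V V)) (weight_space 0 (tensor_rep W W)))
          \<ge> 2 * vec.dim (weight_space 1 (tensor_rep V W)) \<and>
        vec.dim (direct_sum (weight_space 0 (tensor_rep V V)) (weight_space 0 (tensor_rep W W)))
          \<noteq> 2 * vec.dim (weight_space 1 (tensor_rep V W)))"
proof (rule conjI[OF _ conjI]; rule impI)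
  note V = assms(1) and W = assms(2)
  have VT: "representation torus_SU2 V" and WT: "representation torus_SU2 W"
    using V W representation_subset torus_SU2_subset by blast+
  show "vec.dim (direct_sum (weight_space 0 (tensor_rep V V)) (weight_space 0 (tensor_rep W W)))
          \<ge> 2 * vec.dim (weight_space 0 (tensor_rep V W)) \<and>
        (vec.dim (direct_sum (weight_space 0 (tensor_rep V V)) (weight_space 0 (tensor_rep W W)))
          = 2 * vec.dim (weight_space 0 (tensor_rep V W)) \<longleftrightarrow> rep_iso SU2 V W)"
    using tensor_dim_inequality[OF compact_matrix_group_torus_SU2 VT WT
        SU2_torus_trace_real[OF V] SU2_torus_trace_real[OF W]]
      rep_iso_subgroup_iff[OF compact_matrix_group_SU2 V W torus_SU2_subset SU2_conjugate_torus]
    by (simp add: weight_space_0)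
  show "vec.dim (direct_sum (weight_space 0 (tensor_rep V V)) (weight_space 0 (tensor_rep W W)))
          \<ge> 2 * vec.dim (weight_space 1 (tensor_rep V W)) \<and>
        vec.dim (direct_sum (weight_space 0 (tensor_rep V V)) (weight_space 0 (tensor_rep W W)))
          \<noteq> 2 * vec.dim (weight_space 1 (tensor_rep V W))"
    using weight_1_dim_inequality[OF V W] by simp
next
  assume asm: "compact_matrix_group G \<and> maximal_torus G T \<and>
      representation G X \<and> representation G Y \<and> self_dual G X \<and> self_dual G Y \<and>
      has_central_character G X \<omega> \<and> has_central_character G Y \<omega>"
  then have G: "compact_matrix_group G" and X: "representation G X" and Y: "representation G Y"
    and sd: "self_dual G X" "self_dual G Y" and TG: "T \<subseteq> G" and T: "compact_matrix_group T"
    by (auto simp: maximal_torus_def torus_group_def)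
  note ineq = tensor_dim_inequality[OF T representation_subset[OF X TG] representation_subset[OF Y TG]
      self_dual_trace_real[OF G X sd(1) subsetD[OF TG]] self_dual_trace_real[OF G Y sd(2) subsetD[OF TG]]]
  show "vec.dim (direct_sum (zero_weight_space T (tensor_rep X X))
                            (zero_weight_space T (tensor_rep Y Y)))
          \<ge> 2 * vec.dim (zero_weight_space T (tensor_rep X Y)) \<and>
        (vec.dim (direct_sum (zero_weight_space T (tensor_rep X X))
                             (zero_weight_space T (tensor_rep Y Y)))
          = 2 * vec.dim (zero_weight_space T (tensor_rep X Y)) \<longleftrightarrow> rep_iso T X Y) \<and>
        ((\<forall>g\<in>G. \<exists>h\<in>G. \<exists>t\<in>T. g = h ** t ** matrix_inv h) \<longrightarrow>
          (vec.dim (direct_sum (zero_weight_space T (tensor_rep X X))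
                               (zero_weight_space T (tensor_rep Y Y)))
            = 2 * vec.dim (zero_weight_space T (tensor_rep X Y)) \<longleftrightarrow> rep_iso G X Y))"
    using ineq rep_iso_subgroup_iff[OF G X Y TG] by blast
qed

end
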